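(* Let $t,s\in C^{\log}_{loc}(\mathbb{T}^{n})\cap L^{\infty}(\mathbb{T}^{n})$ with $s(x)\ge s^{-}>0$, $q\in\mathcal{P}^{\log}(\mathbb{T}^{n})$, $\delta>0$, and assume $t(x)-s(x)+\frac{n}{q^{+}}\ne0$ for every $x\in\mathbb{T}^{n}$. Let $$u=\sum_{j=0}^{\infty}\sum_{G\in G^{j}}\sum_{m\in\mathbb{M}_{j}}\gamma^{j}_{Gm}\xi^{j}_{Gm}\tilde\Psi^{j}_{Gm},\qquad\gamma^{j}_{Gm}=2^{-j\left(s(2^{-j}m)+\frac n2-\frac n{q^{+}}\right)}\left(\frac1\delta\right)^{1/q^{+}},$$ where the $\xi^{j}_{Gm}$ are i.i.d. draws from the centered generalized $q(\cdot)$-exponential distribution with $\kappa(dx)=dx$ (the uniform probability measure on $\mathbb{T}^{n}$); in other words, $u$ is distributed according to a $(\delta,B^{s(\cdot)}_{q(\cdot)})$ measure. Then the following are equivalent: (1) $\rho_{B^{t(\cdot)}_{q(\cdot)}}(u)<\infty$ $\mathbb{P}$-almost surely; (2) $\mathbb{E}\left(\exp\left(\alpha\,\rho_{B^{t(\cdot)}_{q(\cdot)}}(u)\right)\right)<\infty$ for any $\alpha\in[0,\delta/2)$; (3) $\sup_{x\in\mathbb{T}^{n}}\left(t(x)-s(x)+\frac{n}{q^{+}}\right)<0$.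
   Context: $\mathbb{T}^{n}$ is the $n$-dimensional torus, $n\le3$. $\mathcal{P}$ is the set of measurable $q:\mathbb{T}^{n}\to[1,\infty)$; $q^{\pm}$ are the essential sup/inf. $g\in C^{\log}_{loc}(\mathbb{T}^{n})$ means $|g(x)-g(y)|\le c/\log(e+1/|x-y|)$ for all $x,y$ and some $c>0$; $g\in C^{\log}$ if moreover $|g(x)-g_\infty|\le c/\log(e+|x|)$ for some $g_\infty$. $\mathcal{P}^{\log}$: those $q\in\mathcal{P}$ with $1/q\in C^{\log}$ and $1\le q^{-}\le q^{+}<\infty$. Wavelets: $\psi^{F},\psi^{M}$ are the scaling function and wavelet of an orthonormal Meyer system on $\mathbb{R}$, or of a Daubechies system of regularity $k$ (compactly supported, in $C^k$, with $k$ vanishing moments of $\psi^M$), with $k$ large enough for the wavelet characterization of the spaces involved ($k>\max(-r^{-},r^{+})$ for $r\in\{s,t\}$). $G^{0}=\{F,M\}^{n}$; for $j\ge1$, $G^{j}$ is the set of $G\in\{F,M\}^{n}$ with at least one entry $M$; $\mathbb{M}_{j}=\{0,\dots,2^{j}-1\}^{n}$; $\tilde\Psi^{j}_{Gm}(x)=\prod_{r=1}^{n}\sum_{\ell\in\mathbb{Z}}2^{j/2}\psi^{G_{r}}(2^{j}(x_{r}+\ell)-m_{r})$, an orthonormal basis of $L^{2}(\mathbb{T}^{n})$. Generalized $q(\cdot)$-exponential distribution with probability measure $\kappa$ on $\mathbb{T}^{n}$: the centered measure on $\mathbb{R}$ with density proportional to $x\mapsto\exp\left(-\frac12\int_{\mathbb{T}^{n}}|x|^{q(y)}\kappa(dy)\right)$.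 Modular: with $\lambda^{j}_{Gm}=2^{jn/2}\langle u,\tilde\Psi^{j}_{Gm}\rangle$, $$\rho_{B^{t(\cdot)}_{q(\cdot)}}(u)=\int_{\mathbb{T}^{n}}\sum_{j=0}^{\infty}\sum_{G\in G^{j}}\sum_{m\in\mathbb{M}_{j}}2^{jq(x)t(2^{-j}m)}|\lambda^{j}_{Gm}|^{q(x)}\chi_{jm}(x)\,dx,$$ where $\chi_{jm}$ is the indicator function of the dyadic cube in $\mathbb{T}^{n}$ of side $2^{-j}$ associated with the point $2^{-j}m$. *)

theory Defs
  imports "HOL-Probability.Probability" "HOL-Probability.Essential_Supremum"
begin

text \<open>
  The torus is the quotient of \<open>real^'n\<close> by the integer lattice. A function on the torus is a
  lattice-periodic function on \<open>real^'n\<close>, and integration is over the fundamental domain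
  \<open>[0,1)^n\<close>, where \<open>n = CARD('n)\<close>.
\<close>

definition int_lattice :: "(real^'n) set" where
  "int_lattice = {k. \<forall>i. k $ i \<in> \<int>}"

definition torus_fun :: "(real^'n \<Rightarrow> real) \<Rightarrow> bool" where
  "torus_fun g \<longleftrightarrow> (\<forall>x. \<forall>k\<in>int_lattice. g (x + k) = g x)"

definition torus_measure :: "(real^'n) measure" where
  "torus_measure = restrict_space lborel {x. \<forall>i. 0 \<le> x $ i \<and> x $ i < 1}"

text \<open>The distance on the torus is \<open>torus_norm (x - y)\<close>.\<close>

definition torus_norm :: "real^'n \<Rightarrow> real" where
  "torus_norm x = (INF k\<in>int_lattice. norm (x + k))"

definition torus_inner :: "(real^'n \<Rightarrow> real) \<Rightarrow> (real^'n \<Rightarrow> real) \<Rightarrow> real" where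
  "torus_inner f g = (\<integral>x. f x * g x \<partial>torus_measure)"

definition ess_sup :: "(real^'n \<Rightarrow> real) \<Rightarrow> ereal" where
  "ess_sup g = esssup torus_measure (\<lambda>x. ereal (g x))"

definition ess_inf :: "(real^'n \<Rightarrow> real) \<Rightarrow> ereal" where
  "ess_inf g = - ess_sup (\<lambda>x. - g x)"

definition torus_Linf :: "(real^'n \<Rightarrow> real) \<Rightarrow> bool" where
  "torus_Linf g \<longleftrightarrow> torus_fun g \<and> g \<in> borel_measurable torus_measure
     \<and> ess_sup (\<lambda>x. \<bar>g x\<bar>) < \<infinity>"

text \<open>Both \<open>x\<close> and \<open>x - y\<close> are measured with the torus norm. With the Euclidean norm of the lift
  \<open>x\<close>, the decay condition would force a periodic function to be constant.\<close>

definition C_log_loc :: "(real^'n \<Rightarrow> real) \<Rightarrow> bool" where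
  "C_log_loc g \<longleftrightarrow> torus_fun g \<and>
     (\<exists>c>0. \<forall>x y. \<bar>g x - g y\<bar> \<le> c / ln (exp 1 + 1 / torus_norm (x - y)))"

definition C_log :: "(real^'n \<Rightarrow> real) \<Rightarrow> bool" where
  "C_log g \<longleftrightarrow> C_log_loc g \<and>
     (\<exists>g_inf. \<exists>c>0. \<forall>x. \<bar>g x - g_inf\<bar> \<le> c / ln (exp 1 + torus_norm x))"

definition var_exponent :: "(real^'n \<Rightarrow> real) \<Rightarrow> bool" where
  "var_exponent q \<longleftrightarrow> torus_fun q \<and> q \<in> borel_measurable torus_measure \<and> (\<forall>x. 1 \<le> q x)"

definition var_exponent_log :: "(real^'n \<Rightarrow> real) \<Rightarrow> bool" where
  "var_exponent_log q \<longleftrightarrow> var_exponent q \<and> C_log (\<lambda>x. 1 / q x)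
     \<and> 1 \<le> ess_inf q \<and> ess_inf q \<le> ess_sup q \<and> ess_sup q < \<infinity>"

definition q_plus :: "(real^'n \<Rightarrow> real) \<Rightarrow> real" where
  "q_plus q = real_of_ereal (ess_sup q)"


text \<open>Wavelet systems on the real line: \<open>\<psi> F_type\<close> is the scaling function and \<open>\<psi> M_type\<close> the
  wavelet.\<close>

datatype gender = F_type | M_type

definition dilate :: "(real \<Rightarrow> real) \<Rightarrow> nat \<Rightarrow> int \<Rightarrow> real \<Rightarrow> real" where
  "dilate f j m x = 2 powr (real j / 2) * f (2 ^ j * x - of_int m)"

definition line_index :: "(gender \<times> nat \<times> int) set" where
  "line_index = {(g, j, m). g = F_type \<longrightarrow> j = 0}"

definition square_integrable :: "(real \<Rightarrow> real) \<Rightarrow> bool" where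
  "square_integrable f \<longleftrightarrow> f \<in> borel_measurable lborel \<and> integrable lborel (\<lambda>x. (f x)\<^sup>2)"

text \<open>The integer translates of \<open>\<psi> F_type\<close> and the dilated translates of \<open>\<psi> M_type\<close> at the levels
  \<open>j \<ge> 0\<close> form a complete orthonormal system in \<open>L^2\<close> of the line. Comparing this system with its
  dilation by 2 gives the orthogonal splitting of \<open>V_1\<close> into \<open>V_0\<close> and \<open>W_0\<close>, so the two-scale
  relations of a multiresolution analysis hold.\<close>

definition orthonormal_wavelet_system :: "(gender \<Rightarrow> real \<Rightarrow> real) \<Rightarrow> bool" where
  "orthonormal_wavelet_system \<psi> \<longleftrightarrow>
     (\<forall>g. square_integrable (\<psi> g)) \<and>
     (\<forall>(g, j, m)\<in>line_index. \<forall>(g', j', m')\<in>line_index.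
        (\<integral>x. dilate (\<psi> g) j m x * dilate (\<psi> g') j' m' x \<partial>lborel)
          = (if (g, j, m) = (g', j', m') then 1 else 0)) \<and>
     (\<forall>f. square_integrable f \<longrightarrow>
        (\<forall>(g, j, m)\<in>line_index. (\<integral>x. f x * dilate (\<psi> g) j m x \<partial>lborel) = 0) \<longrightarrow>
        (AE x in lborel. f x = 0))"

definition Ck_fun :: "nat \<Rightarrow> (real \<Rightarrow> real) \<Rightarrow> bool" where
  "Ck_fun k f \<longleftrightarrow> (\<forall>i<k. \<forall>x. (deriv ^^ i) f differentiable (at x))
     \<and> continuous_on UNIV ((deriv ^^ k) f)"

definition schwartz_fun :: "(real \<Rightarrow> real) \<Rightarrow> bool" where
  "schwartz_fun f \<longleftrightarrow> (\<forall>i. (\<forall>x. (deriv ^^ i) f differentiable (at x))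
     \<and> (\<forall>N. bounded (range (\<lambda>x. x ^ N * (deriv ^^ i) f x))))"

definition fourier :: "(real \<Rightarrow> real) \<Rightarrow> real \<Rightarrow> complex" where
  "fourier f \<theta> = (\<integral>x. cis (- (\<theta> * x)) * of_real (f x) \<partial>lborel)"

text \<open>Together with orthonormality, these supports determine the modulus of the Fourier transform
  of the scaling function to be Meyer's: it is 1 for \<open>\<bar>\<theta>\<bar> \<le> 2 * pi / 3\<close>, and the cosine of a
  transition function between there and \<open>4 * pi / 3\<close>.\<close>

definition meyer_system :: "(gender \<Rightarrow> real \<Rightarrow> real) \<Rightarrow> bool" where
  "meyer_system \<psi> \<longleftrightarrow> orthonormal_wavelet_system \<psi> \<and> (\<forall>g. schwartz_fun (\<psi> g)) \<and>
     (\<forall>\<theta>. fourier (\<psi> F_type) \<theta> \<noteq> 0 \<longrightarrow> \<bar>\<theta>\<bar> \<le> 4 * pi / 3) \<and>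
     (\<forall>\<theta>. fourier (\<psi> M_type) \<theta> \<noteq> 0 \<longrightarrow> 2 * pi / 3 \<le> \<bar>\<theta>\<bar> \<and> \<bar>\<theta>\<bar> \<le> 8 * pi / 3)"

definition daubechies_system :: "nat \<Rightarrow> (gender \<Rightarrow> real \<Rightarrow> real) \<Rightarrow> bool" where
  "daubechies_system k \<psi> \<longleftrightarrow> orthonormal_wavelet_system \<psi> \<and>
     (\<forall>g. Ck_fun k (\<psi> g) \<and> (\<exists>R. \<forall>x. R < \<bar>x\<bar> \<longrightarrow> \<psi> g x = 0)) \<and>
     (\<forall>i<k. (\<integral>x. x ^ i * \<psi> M_type x \<partial>lborel) = 0)"

text \<open>The condition on \<open>k\<close> is the one under which the wavelet characterisation holds for a space of
  smoothness \<open>r\<close>, for each \<open>r\<close> in the given set.\<close>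

definition admissible_system ::
    "(real^'n \<Rightarrow> real) set \<Rightarrow> (gender \<Rightarrow> real \<Rightarrow> real) \<Rightarrow> bool" where
  "admissible_system S \<psi> \<longleftrightarrow> meyer_system \<psi> \<or>
     (\<exists>k. daubechies_system k \<psi> \<and>
        (\<forall>r\<in>S. max (- ess_inf r) (ess_sup r) < ereal (real k)))"


definition G_level :: "nat \<Rightarrow> (gender^'n) set" where
  "G_level j = (if j = 0 then UNIV else {G. \<exists>i. G $ i = M_type})"

definition M_level :: "nat \<Rightarrow> (nat^'n) set" where
  "M_level j = {m. \<forall>i. m $ i < 2 ^ j}"

definition wavelet_index :: "(nat \<times> (gender^'n) \<times> (nat^'n)) set" where
  "wavelet_index = {(j, G, m). G \<in> G_level j \<and> m \<in> M_level j}"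

definition dyadic_point :: "nat \<Rightarrow> nat^'n \<Rightarrow> real^'n" where
  "dyadic_point j m = (\<chi> i. real (m $ i) / 2 ^ j)"

text \<open>The half-open cube with lower corner \<open>2^{-j} m\<close>; for fixed \<open>j\<close> these cubes partition the
  fundamental domain.\<close>

definition dyadic_cube :: "nat \<Rightarrow> nat^'n \<Rightarrow> (real^'n) set" where
  "dyadic_cube j m =
     {x. \<forall>i. real (m $ i) / 2 ^ j \<le> x $ i \<and> x $ i < (real (m $ i) + 1) / 2 ^ j}"

definition periodic_wavelet ::
    "(gender \<Rightarrow> real \<Rightarrow> real) \<Rightarrow> nat \<Rightarrow> gender^'n \<Rightarrow> nat^'n \<Rightarrow> real^'n \<Rightarrow> real" where
  "periodic_wavelet \<psi> j G m x =
     (\<Prod>i\<in>UNIV. \<Sum>\<^sub>\<infinity>l\<in>(UNIV::int set).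
        2 powr (real j / 2) * \<psi> (G $ i) (2 ^ j * (x $ i + of_int l) - real (m $ i)))"

text \<open>
  Generalised functions on the torus are represented by their action on test functions \<open>\<phi>\<close>. They
  are needed because the random series below need not converge in \<open>L^2\<close>: the wavelet coefficients
  of the sum are then duality pairings and not \<open>L^2\<close> inner products. The series with coefficients
  \<open>a\<close> acts by summing the pairings of its terms with \<open>\<phi>\<close>. If \<open>\<phi>\<close> is itself one of the wavelets,
  orthonormality leaves a single nonzero term. Where the series diverges the value is arbitrary;
  \<open>wavelet_coeff\<close> evaluates it on wavelets only.
\<close>

type_synonym 'n gen_fun = "(real^'n \<Rightarrow> real) \<Rightarrow> real"

definition wavelet_series ::
    "(gender \<Rightarrow> real \<Rightarrow> real) \<Rightarrow> (nat \<Rightarrow> gender^'n \<Rightarrow> nat^'n \<Rightarrow> real) \<Rightarrow> 'n gen_fun" where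
  "wavelet_series \<psi> a \<phi> =
     (\<Sum>j. \<Sum>G\<in>G_level j. \<Sum>m\<in>M_level j. a j G m * torus_inner (periodic_wavelet \<psi> j G m) \<phi>)"

definition wavelet_coeff ::
    "(gender \<Rightarrow> real \<Rightarrow> real) \<Rightarrow> 'n gen_fun \<Rightarrow> nat \<Rightarrow> gender^'n \<Rightarrow> nat^'n \<Rightarrow> real" where
  "wavelet_coeff \<psi> u j G m =
     2 powr (real j * real CARD('n) / 2) * u (periodic_wavelet \<psi> j G m)"

text \<open>The modular may be infinite, so it takes values in \<open>ennreal\<close>.\<close>

definition besov_modular ::
    "(gender \<Rightarrow> real \<Rightarrow> real) \<Rightarrow> (real^'n \<Rightarrow> real) \<Rightarrow> (real^'n \<Rightarrow> real) \<Rightarrow> 'n gen_fun \<Rightarrow> ennreal" where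
  "besov_modular \<psi> t q u =
     (\<integral>\<^sup>+x. (\<Sum>j. \<Sum>G\<in>G_level j. \<Sum>m\<in>M_level j.
        ennreal (2 powr (real j * q x * t (dyadic_point j m))
          * \<bar>wavelet_coeff \<psi> u j G m\<bar> powr q x * indicator (dyadic_cube j m) x))
      \<partial>torus_measure)"

definition ennreal_exp :: "ennreal \<Rightarrow> ennreal" where
  "ennreal_exp a = (if a = \<infinity> then \<infinity> else ennreal (exp (enn2real a)))"


definition gen_exp_weight :: "(real^'n \<Rightarrow> real) \<Rightarrow> (real^'n) measure \<Rightarrow> real \<Rightarrow> real" where
  "gen_exp_weight q \<kappa> x = exp (- (1 / 2) * (\<integral>y. \<bar>x\<bar> powr q y \<partial>\<kappa>))"

definition gen_exp_distribution :: "(real^'n \<Rightarrow> real) \<Rightarrow> (real^'n) measure \<Rightarrow> real measure" where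
  "gen_exp_distribution q \<kappa> =
     density lborel (\<lambda>x. ennreal (gen_exp_weight q \<kappa> x / (\<integral>z. gen_exp_weight q \<kappa> z \<partial>lborel)))"

definition besov_scale ::
    "real \<Rightarrow> (real^'n \<Rightarrow> real) \<Rightarrow> (real^'n \<Rightarrow> real) \<Rightarrow> nat \<Rightarrow> nat^'n \<Rightarrow> real" where
  "besov_scale \<delta> s q j m =
     2 powr (- (real j * (s (dyadic_point j m) + real CARD('n) / 2 - real CARD('n) / q_plus q)))
     * (1 / \<delta>) powr (1 / q_plus q)"

end

theory Submission
  imports Defs
begin

text \<open>
  Periodising an orthonormal system of the line whose generators decay like \<open>1 / (1 + x\<^sup>2)\<close>
  gives an orthonormal system on the torus, so the wavelet coefficients of \<open>u\<close> are the
  scaled \<open>\<xi> (j, G, m)\<close> and the modular is a sum of independent terms \<open>F\<^sub>i(\<xi>\<^sub>i)\<close>, where \<open>F\<^sub>i(z)\<close>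
  is the integral of \<open>2 powr (j r q) * \<delta> powr (- q / q\<^sup>+) * \<bar>z\<bar> powr q\<close> over a dyadic cube, with
  \<open>r = t - s + n / q\<^sup>+\<close> taken at the corner of the cube. Since \<open>r\<close> is continuous, periodic and never 0,
  either \<open>r \<le> - c < 0\<close> or \<open>r > 0\<close>.

  If \<open>r \<le> - c\<close>, then \<open>F\<^sub>i(z) \<le> A * 2 powr (- j c - j n) * (1 + \<bar>z\<bar>) powr q\<^sup>+\<close>, and
  \<open>exp y \<le> 1 + y * exp y\<close> bounds each factor of the exponential moment by \<open>1 + K * 2 powr (- j c - j n)\<close>;
  there are about \<open>2 ^ (j n)\<close> factors at level \<open>j\<close>, so the product converges. The constant \<open>K\<close> is
  finite because \<open>\<alpha> < \<delta> / 2\<close> makes the density beat \<open>exp (\<alpha> F\<^sub>i)\<close>: where \<open>q\<close> is near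
  \<open>q\<^sup>+\<close> the factor \<open>\<alpha> * \<delta> powr (- q / q\<^sup>+)\<close> stays below \<open>1 / 2\<close>, and smaller values
  of \<open>q\<close> contribute a lower power of \<open>\<bar>z\<bar>\<close>.

  If \<open>r > 0\<close>, then \<open>F\<^sub>i(z) \<ge> C * 2 powr (- j n) * min 1 \<bar>z\<bar> powr q\<^sup>+\<close>, so
  the expectation of \<open>exp\<close> of minus the sum over \<open>N\<close> levels decays exponentially in \<open>N\<close> and the
  modular is almost surely infinite.
\<close>

section \<open>Periodisation of functions with quadratic decay\<close>

text \<open>Both Meyer and Daubechies generators satisfy this. The bound is integrable over the line
  and summable over the integers, and the class is stable under dilations and translations, which is
  what periodisation requires.\<close>

definition quad_decay :: "(real \<Rightarrow> real) \<Rightarrow> bool" where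
  "quad_decay f \<longleftrightarrow> f \<in> borel_measurable borel \<and> (\<exists>C. \<forall>x. \<bar>f x\<bar> \<le> C / (1 + x\<^sup>2))"

text \<open>The unordered sum is the one in \<open>periodic_wavelet\<close>, so each factor there is
  the periodisation of a \<open>dilate\<close>.\<close>

definition periodize :: "(real \<Rightarrow> real) \<Rightarrow> real \<Rightarrow> real" where
  "periodize f x = (\<Sum>\<^sub>\<infinity>l\<in>(UNIV::int set). f (x + of_int l))"

lemma quad_decay_bound:
  assumes "quad_decay f"
  obtains C where "0 \<le> C" "\<And>x. \<bar>f x\<bar> \<le> C / (1 + x\<^sup>2)"
proof -
  obtain C where C: "\<And>x. \<bar>f x\<bar> \<le> C / (1 + x\<^sup>2)"
    using assms by (auto simp: quad_decay_def)
  have "0 \<le> C" using C[of 0] by simp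
  with C show ?thesis using that by blast
qed

lemma integrable_quad_decay:
  assumes "quad_decay f"
  shows "integrable lborel f"
proof -
  obtain C where C: "0 \<le> C" "\<And>x. \<bar>f x\<bar> \<le> C / (1 + x\<^sup>2)"
    using quad_decay_bound[OF assms] by blast
  have "integrable lborel (\<lambda>x. inverse (1 + x\<^sup>2) :: real)"
    using integrable_inverse_1_plus_square by (simp add: set_integrable_def)
  hence "integrable lborel (\<lambda>x. C * inverse (1 + x\<^sup>2))" by simp
  thus ?thesis
  proof (rule Bochner_Integration.integrable_bound)
    show "f \<in> borel_measurable lborel" using assms by (simp add: quad_decay_def)
    show "AE x in lborel. norm (f x) \<le> norm (C * inverse (1 + x\<^sup>2))"
    proof (intro AE_I2)
      fix x :: real
      have "norm (f x) \<le> C / (1 + x\<^sup>2)" using C(2)[of x] by simp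
      also have "\<dots> \<le> norm (C * inverse (1 + x\<^sup>2))" by (simp add: divide_inverse)
      finally show "norm (f x) \<le> norm (C * inverse (1 + x\<^sup>2))" .
    qed
  qed
qed

lemma summable_on_int_inverse_quad:
  "(\<lambda>l::int. 1 / (1 + (real_of_int l)\<^sup>2)) summable_on UNIV"
proof -
  have nat: "(\<lambda>n::nat. 1 / (1 + (real n)\<^sup>2)) summable_on UNIV"
  proof (rule norm_summable_imp_summable_on, rule summable_comparison_test')
    show "summable (\<lambda>n. inverse (real n ^ 2))" by (rule inverse_power_summable) simp
    show "norm (norm (1 / (1 + (real n)\<^sup>2))) \<le> inverse (real n ^ 2)" if "1 \<le> n" for n
      using that by (auto simp: inverse_eq_divide intro!: frac_le)
  qed
  have "(\<lambda>l::int. 1 / (1 + (real_of_int l)\<^sup>2)) summable_on range int"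
    by (subst summable_on_reindex) (use nat in \<open>auto simp: o_def inj_def\<close>)
  moreover have "(\<lambda>l::int. 1 / (1 + (real_of_int l)\<^sup>2)) summable_on range (\<lambda>n. - int n)"
    by (subst summable_on_reindex) (use nat in \<open>auto simp: o_def inj_def\<close>)
  ultimately have "(\<lambda>l::int. 1 / (1 + (real_of_int l)\<^sup>2)) summable_on (range int \<union> range (\<lambda>n. - int n))"
    by (rule summable_on_union)
  moreover have "range int \<union> range (\<lambda>n. - int n) = UNIV"
    by (auto simp: image_iff) (metis int_cases2)
  ultimately show ?thesis by simp
qed

text \<open>Peetre's inequality: changing the base point by x costs only a factor depending on x, so
  decay in x + l becomes decay in l.\<close>

lemma quad_decay_shift_bound:
  assumes "0 \<le> C" "\<And>x. \<bar>f x\<bar> \<le> C / (1 + x\<^sup>2)"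
  shows "\<bar>f (x + of_int l)\<bar> \<le> (C * (2 + 2 * x\<^sup>2)) * (1 / (1 + (real_of_int l)\<^sup>2))"
proof -
  define y where "y = x + real_of_int l"
  have l: "real_of_int l = y - x" by (simp add: y_def)
  have "1 + (y - x)\<^sup>2 \<le> (2 + 2 * x\<^sup>2) * (1 + y\<^sup>2)"
  proof -
    \<comment> \<open>This sum is the right-hand side minus the left-hand side of the
      inequality.\<close>
    have "0 \<le> (y + x)\<^sup>2 + 1 + 2 * x\<^sup>2 * y\<^sup>2" by simp
    thus ?thesis by (simp add: power2_eq_square algebra_simps)
  qed
  hence "1 / (1 + y\<^sup>2) \<le> (2 + 2 * x\<^sup>2) * (1 / (1 + (y - x)\<^sup>2))"
    by (simp add: divide_simps add_pos_nonneg)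
  hence "C * (1 / (1 + y\<^sup>2)) \<le> C * ((2 + 2 * x\<^sup>2) * (1 / (1 + (y - x)\<^sup>2)))"
    using assms(1) by (rule mult_left_mono)
  with assms(2)[of y] show ?thesis by (simp add: l mult.assoc y_def[symmetric])
qed

lemma summable_on_quad_decay_shift:
  assumes "quad_decay f"
  shows "(\<lambda>l::int. norm (f (x + of_int l))) summable_on UNIV"
proof -
  obtain C where C: "0 \<le> C" "\<And>x. \<bar>f x\<bar> \<le> C / (1 + x\<^sup>2)"
    using quad_decay_bound[OF assms] by blast
  show ?thesis
  proof (rule summable_on_comparison_test)
    show "(\<lambda>l. (C * (2 + 2 * x\<^sup>2)) * (1 / (1 + (real_of_int l)\<^sup>2))) summable_on UNIV"
      by (intro summable_on_cmult_right summable_on_int_inverse_quad)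
  qed (use quad_decay_shift_bound[OF C] in auto)
qed

text \<open>Enumerating the integers turns the unordered sum into an ordinary series, the form used
  for measurability and termwise integration.\<close>

lemma summable_periodize:
  assumes "quad_decay f"
  shows "summable (\<lambda>n. \<bar>f (x + of_int (int_decode n))\<bar>)"
    and "(\<lambda>n. f (x + of_int (int_decode n))) sums periodize f x"
proof -
  have "(\<lambda>l::int. \<bar>f (x + of_int l)\<bar>) summable_on UNIV"
    using summable_on_quad_decay_shift[OF assms] by simp
  hence "(\<lambda>n. \<bar>f (x + of_int (int_decode n))\<bar>) summable_on UNIV"
    using summable_on_reindex_bij_betw[OF bij_int_decode, of "\<lambda>l. \<bar>f (x + of_int l)\<bar>"] by simp
  thus s: "summable (\<lambda>n. \<bar>f (x + of_int (int_decode n))\<bar>)" by (rule summable_on_imp_summable)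
  have "(\<lambda>l::int. f (x + of_int l)) summable_on UNIV"
    using summable_on_quad_decay_shift[OF assms] by (rule abs_summable_summable)
  hence "(\<lambda>n. f (x + of_int (int_decode n))) summable_on UNIV"
    using summable_on_reindex_bij_betw[OF bij_int_decode, of "\<lambda>l. f (x + of_int l)"] by simp
  hence "((\<lambda>n. f (x + of_int (int_decode n))) has_sum (\<Sum>\<^sub>\<infinity>n. f (x + of_int (int_decode n)))) UNIV"
    by (rule has_sum_infsum)
  moreover have "(\<Sum>\<^sub>\<infinity>n. f (x + of_int (int_decode n))) = periodize f x"
    unfolding periodize_def
    using infsum_reindex_bij_betw[OF bij_int_decode, of "\<lambda>l. f (x + of_int l)"] by simp
  ultimately show "(\<lambda>n. f (x + of_int (int_decode n))) sums periodize f x"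
    using has_sum_imp_sums by force
qed

lemma periodize_measurable [measurable]:
  assumes [measurable]: "quad_decay f"
  shows "periodize f \<in> borel_measurable borel"
proof -
  have [measurable]: "f \<in> borel_measurable borel" using assms by (simp add: quad_decay_def)
  have "periodize f = (\<lambda>x. \<Sum>n. f (x + of_int (int_decode n)))"
    using summable_periodize(2)[OF assms] by (auto simp: sums_iff)
  thus ?thesis by simp
qed

lemma periodize_shift: "periodize f (x + of_int k) = periodize f x"
proof -
  have "bij (\<lambda>l::int. k + l)" by (rule bij_plus)
  from infsum_reindex_bij_betw[OF this, of "\<lambda>l. f (x + of_int l)"] show ?thesis
    by (simp add: periodize_def add.assoc)
qed

text \<open>By periodicity x may be taken in [0, 1], where the factor 2 + 2 x^2 of the shift bound
  is at most 4. The bound on partial sums provides the domination for exchanging sum and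
  integral.\<close>

lemma periodize_bounded:
  assumes "quad_decay f"
  obtains B where "0 \<le> B" "\<And>x. \<bar>periodize f x\<bar> \<le> B"
    "\<And>x N. (\<Sum>n<N. \<bar>f (x + of_int (int_decode n))\<bar>) \<le> B"
proof -
  obtain C where C: "0 \<le> C" "\<And>x. \<bar>f x\<bar> \<le> C / (1 + x\<^sup>2)"
    using quad_decay_bound[OF assms] by blast
  define B where "B = (\<Sum>\<^sub>\<infinity>l::int. (C * 4) * (1 / (1 + (real_of_int l)\<^sup>2)))"
  have B0: "0 \<le> B" unfolding B_def using C(1) by (intro infsum_nonneg) auto
  have bd01: "(\<Sum>\<^sub>\<infinity>l::int. \<bar>f (x + of_int l)\<bar>) \<le> B" if "0 \<le> x" "x \<le> 1" for x
    unfolding B_def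
  proof (rule infsum_mono)
    show "(\<lambda>l::int. \<bar>f (x + of_int l)\<bar>) summable_on UNIV"
      using summable_on_quad_decay_shift[OF assms] by simp
    show "(\<lambda>l. (C * 4) * (1 / (1 + (real_of_int l)\<^sup>2))) summable_on UNIV"
      by (intro summable_on_cmult_right summable_on_int_inverse_quad)
    fix l :: int
    have "x\<^sup>2 \<le> 1" using that by (simp add: abs_square_le_1)
    hence "C * (2 + 2 * x\<^sup>2) \<le> C * 4" using C(1) by (intro mult_left_mono) auto
    hence "(C * (2 + 2 * x\<^sup>2)) * (1 / (1 + (real_of_int l)\<^sup>2)) \<le> (C * 4) * (1 / (1 + (real_of_int l)\<^sup>2))"
      by (intro mult_right_mono) auto
    with quad_decay_shift_bound[OF C, of x l] show "\<bar>f (x + of_int l)\<bar> \<le> (C * 4) * (1 / (1 + (real_of_int l)\<^sup>2))"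
      by linarith
  qed
  have bd: "(\<Sum>\<^sub>\<infinity>l::int. \<bar>f (x + of_int l)\<bar>) \<le> B" for x
  proof -
    have eq: "periodize (\<lambda>x. \<bar>f x\<bar>) x = periodize (\<lambda>x. \<bar>f x\<bar>) (frac x)"
      using periodize_shift[of "\<lambda>x. \<bar>f x\<bar>" "frac x" "\<lfloor>x\<rfloor>"] by (simp add: frac_def)
    show ?thesis using bd01[of "frac x"] eq
      by (simp add: periodize_def frac_lt_1 less_imp_le)
  qed
  have p: "\<bar>periodize f x\<bar> \<le> B" for x
  proof -
    have "norm (periodize f x) \<le> (\<Sum>\<^sub>\<infinity>l::int. norm (f (x + of_int l)))"
      unfolding periodize_def by (rule norm_infsum_bound) (use summable_on_quad_decay_shift[OF assms] in auto)
    with bd[of x] show ?thesis by simp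
  qed
  have "(\<Sum>n<N. \<bar>f (x + of_int (int_decode n))\<bar>) \<le> B" for x N
  proof -
    have "quad_decay (\<lambda>x. \<bar>f x\<bar>)" using assms by (auto simp: quad_decay_def)
    from summable_periodize(2)[OF this, of x] bd[of x]
    have le: "(\<Sum>n. \<bar>f (x + of_int (int_decode n))\<bar>) \<le> B" by (simp add: periodize_def sums_iff)
    have "(\<Sum>n<N. \<bar>f (x + of_int (int_decode n))\<bar>) \<le> (\<Sum>n. \<bar>f (x + of_int (int_decode n))\<bar>)"
      using summable_periodize(1)[OF assms] by (intro sum_le_suminf) auto
    with le show ?thesis by linarith
  qed
  with B0 p show ?thesis using that by blast
qed

lemma quad_decay_mult_bounded:
  assumes "quad_decay f" "g \<in> borel_measurable borel" "\<And>x. \<bar>g x\<bar> \<le> B"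
  shows "quad_decay (\<lambda>x. f x * g x)"
proof -
  obtain C where C: "0 \<le> C" "\<And>x. \<bar>f x\<bar> \<le> C / (1 + x\<^sup>2)"
    using quad_decay_bound[OF assms(1)] by blast
  have "\<bar>f x * g x\<bar> \<le> (C * B) / (1 + x\<^sup>2)" for x
    using mult_mono[OF C(2)[of x] assms(3)[of x]] C(1) by (simp add: abs_mult)
  moreover have "(\<lambda>x. f x * g x) \<in> borel_measurable borel"
    using assms(1,2) by (auto simp: quad_decay_def)
  ultimately show ?thesis by (auto simp: quad_decay_def)
qed

text \<open>The unit intervals between consecutive integers tile the line, and translating each back
  to [0, 1) leaves g unchanged, so the integral over the line folds up into the periodisation. Sum
  and integral are exchanged by the uniform bound on partial sums.\<close>

lemma integral_periodize_mult:
  assumes f: "quad_decay f" and g: "g \<in> borel_measurable borel" "\<And>x. \<bar>g x\<bar> \<le> B"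
    and per: "\<And>x k. g (x + of_int k) = g x"
  shows "(\<integral>x. indicator {0..<1} x * (periodize f x * g x) \<partial>lborel) = (\<integral>x. f x * g x \<partial>lborel)"
proof -
  have [measurable]: "f \<in> borel_measurable borel" "g \<in> borel_measurable borel"
    using f g(1) by (auto simp: quad_decay_def)
  define A where "A n = {real_of_int (int_decode n)..<real_of_int (int_decode n) + 1}" for n
  have UA: "(\<Union>n. A n) = UNIV"
  proof -
    have "x \<in> A (int_encode \<lfloor>x\<rfloor>)" for x by (simp add: A_def)
    thus ?thesis by blast
  qed
  have disj: "A i \<inter> A j = {}" if "i \<noteq> j" for i j
  proof -
    have "int_decode i \<noteq> int_decode j" using that by (metis int_decode_inverse)
    thus ?thesis by (auto simp: A_def)
  qed
  have fg: "quad_decay (\<lambda>x. f x * g x)" by (rule quad_decay_mult_bounded[OF f g])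
  have int: "integrable lborel (\<lambda>x. f x * g x)" by (rule integrable_quad_decay[OF fg])
  have seg: "(LINT x:A n|lborel. f x * g x) =
      (\<integral>x. indicator {0..<1} x * (f (x + of_int (int_decode n)) * g x) \<partial>lborel)" for n
  proof -
    have "(LINT x:A n|lborel. f x * g x)
        = (\<integral>x. indicator (A n) (of_int (int_decode n) + x) * (f (of_int (int_decode n) + x) * g (of_int (int_decode n) + x)) \<partial>lborel)"
      unfolding set_lebesgue_integral_def
      by (subst lborel_integral_real_affine[of 1 _ "of_int (int_decode n)"]) auto
    also have "\<dots> = (\<integral>x. indicator {0..<1} x * (f (x + of_int (int_decode n)) * g x) \<partial>lborel)"
      by (intro Bochner_Integration.integral_cong) (auto simp: A_def indicator_def per add.commute)
    finally show ?thesis .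
  qed
  have "(\<integral>x. f x * g x \<partial>lborel) = (LINT x:(\<Union>n. A n)|lborel. f x * g x)"
    by (simp add: UA set_lebesgue_integral_def)
  also have "\<dots> = (\<Sum>n. LINT x:A n|lborel. f x * g x)"
    by (rule lebesgue_integral_countable_add) (use disj int in \<open>auto simp: A_def UA[unfolded A_def] set_integrable_def\<close>)
  also have "\<dots> = (\<Sum>n. \<integral>x. indicator {0..<1} x * (f (x + of_int (int_decode n)) * g x) \<partial>lborel)"
    by (simp only: seg)
  also have "\<dots> = (\<integral>x. (\<Sum>n. indicator {0..<1} x * (f (x + of_int (int_decode n)) * g x)) \<partial>lborel)"
  proof (rule integral_suminf[symmetric])
    obtain K where K: "\<And>x N. (\<Sum>n<N. \<bar>f (x + of_int (int_decode n))\<bar>) \<le> K"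
      using periodize_bounded[OF f] by metis
    \<comment> \<open>Peetre's inequality again, now with the shift k fixed and x variable, so that
      each single translate is integrable.\<close>
    have shift: "quad_decay (\<lambda>x. f (x + of_int k))" for k
    proof -
      obtain C where C: "0 \<le> C" "\<And>x. \<bar>f x\<bar> \<le> C / (1 + x\<^sup>2)"
        using quad_decay_bound[OF f] by blast
      have "\<bar>f (x + of_int k)\<bar> \<le> (C * (2 + 2 * (real_of_int k)\<^sup>2)) / (1 + x\<^sup>2)" for x
      proof -
        have "1 + x\<^sup>2 \<le> (2 + 2 * (real_of_int k)\<^sup>2) * (1 + (x + of_int k)\<^sup>2)"
        proof -
          have "0 \<le> (x + 2 * real_of_int k)\<^sup>2 + 1 + 2 * (real_of_int k)\<^sup>2 * (x + real_of_int k)\<^sup>2" by simp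
          thus ?thesis by (simp add: power2_eq_square algebra_simps)
        qed
        hence "1 / (1 + (x + of_int k)\<^sup>2) \<le> (2 + 2 * (real_of_int k)\<^sup>2) / (1 + x\<^sup>2)"
          by (simp add: divide_simps add_pos_nonneg)
        hence "C * (1 / (1 + (x + of_int k)\<^sup>2)) \<le> C * ((2 + 2 * (real_of_int k)\<^sup>2) / (1 + x\<^sup>2))"
          using C(1) by (rule mult_left_mono)
        with C(2)[of "x + of_int k"] show ?thesis by simp
      qed
      moreover have "(\<lambda>x. f (x + of_int k)) \<in> borel_measurable borel" by measurable
      ultimately show ?thesis by (auto simp: quad_decay_def)
    qed
    show i: "integrable lborel (\<lambda>x. indicator {0..<1} x * (f (x + of_int (int_decode n)) * g x))" for n
      using integrable_real_mult_indicator[of "{0..<1}", OF _ integrable_quad_decay[OF quad_decay_mult_bounded[OF shift g]]]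
      by (simp add: mult.commute)
    have s: "summable (\<lambda>n. norm (indicator {0..<1} x * (f (x + of_int (int_decode n)) * g x)))" for x :: real
      using summable_mult[OF summable_periodize(1)[OF f, of x], of "\<bar>indicator {0..<1} x * g x\<bar>"]
      by (simp add: abs_mult mult_ac)
    thus "AE x in lborel. summable (\<lambda>n. norm (indicator {0..<1} x * (f (x + of_int (int_decode n)) * g x)))"
      by simp
    have B0: "0 \<le> B" using g(2)[of 0] by simp
    show "summable (\<lambda>n. \<integral>x. norm (indicator {0..<1} x * (f (x + of_int (int_decode n)) * g x)) \<partial>lborel)"
    proof (rule summableI_nonneg_bounded)
      fix N
      have "(\<Sum>n<N. \<integral>x. norm (indicator {0..<1} x * (f (x + of_int (int_decode n)) * g x)) \<partial>lborel)
          = (\<integral>x. (\<Sum>n<N. norm (indicator {0..<1} x * (f (x + of_int (int_decode n)) * g x))) \<partial>lborel)"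
        using i by (intro Bochner_Integration.integral_sum[symmetric] integrable_norm) auto
      also have "\<dots> \<le> (\<integral>x. indicator {0..<1::real} x * (K * B) \<partial>lborel)"
      proof (rule integral_mono)
        show "integrable lborel (\<lambda>x. \<Sum>n<N. norm (indicator {0..<1} x * (f (x + of_int (int_decode n)) * g x)))"
          using i by (intro Bochner_Integration.integrable_sum integrable_norm) auto
        show "integrable lborel (\<lambda>x. indicator {0..<1::real} x * (K * B))" by simp
        fix x :: real
        have "(\<Sum>n<N. norm (indicator {0..<1} x * (f (x + of_int (int_decode n)) * g x)))
           = indicator {0..<1} x * ((\<Sum>n<N. \<bar>f (x + of_int (int_decode n))\<bar>) * \<bar>g x\<bar>)"
          by (simp add: sum_distrib_left sum_distrib_right abs_mult)
        also have "\<dots> \<le> indicator {0..<1} x * (K * B)"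
          using K[where x = x and N = N] g(2)[of x] B0
          by (intro mult_left_mono mult_mono) (auto intro: order_trans[OF sum_nonneg])
        finally show "(\<Sum>n<N. norm (indicator {0..<1} x * (f (x + of_int (int_decode n)) * g x)))
          \<le> indicator {0..<1} x * (K * B)" .
      qed
      finally show "(\<Sum>n<N. \<integral>x. norm (indicator {0..<1} x * (f (x + of_int (int_decode n)) * g x)) \<partial>lborel)
        \<le> (\<integral>x. indicator {0..<1::real} x * (K * B) \<partial>lborel)" .
    qed simp
  qed
  also have "\<dots> = (\<integral>x. indicator {0..<1} x * (periodize f x * g x) \<partial>lborel)"
  proof (rule Bochner_Integration.integral_cong)
    fix x :: real
    show "(\<Sum>n. indicator {0..<1} x * (f (x + of_int (int_decode n)) * g x)) = indicator {0..<1} x * (periodize f x * g x)"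
      using sums_mult2[OF summable_periodize(2)[OF f, of x], of "g x"]
      by (auto simp: sums_iff indicator_def)
  qed simp
  finally show ?thesis by simp
qed

text \<open>Unfolding the first periodisation and expanding the second leaves one line integral per
  integer translate of g; only the untranslated one contributes.\<close>

lemma integral_periodize_periodize:
  assumes f: "quad_decay f" and g: "quad_decay g"
    and orth: "\<And>k::int. (\<integral>x. f x * g (x + of_int k) \<partial>lborel) = (if k = 0 then v else 0)"
  shows "(\<integral>x. indicator {0..<1} x * (periodize f x * periodize g x) \<partial>lborel) = v"
proof -
  have [measurable]: "f \<in> borel_measurable borel" "g \<in> borel_measurable borel"
    using f g by (auto simp: quad_decay_def)
  obtain K where K: "0 \<le> K" "\<And>x. \<bar>periodize g x\<bar> \<le> K"
    "\<And>x N. (\<Sum>n<N. \<bar>g (x + of_int (int_decode n))\<bar>) \<le> K"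
    using periodize_bounded[OF g] by metis
  have "(\<integral>x. indicator {0..<1} x * (periodize f x * periodize g x) \<partial>lborel)
      = (\<integral>x. f x * periodize g x \<partial>lborel)"
    using f g K by (intro integral_periodize_mult periodize_measurable periodize_shift) auto
  also have "\<dots> = (\<integral>x. (\<Sum>n. f x * g (x + of_int (int_decode n))) \<partial>lborel)"
    using sums_mult[OF summable_periodize(2)[OF g]]
    by (intro Bochner_Integration.integral_cong) (auto simp: sums_iff)
  also have "\<dots> = (\<Sum>n. \<integral>x. f x * g (x + of_int (int_decode n)) \<partial>lborel)"
  proof (rule integral_suminf)
    \<comment> \<open>The partial sum with one term is the absolute value of g x itself, because the
      enumeration starts at the integer 0.\<close>
    have gb: "\<bar>g x\<bar> \<le> K" for x
      using K(3)[of "x" 1] by (simp add: int_decode_def sum_decode_def)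
    show i: "integrable lborel (\<lambda>x. f x * g (x + of_int (int_decode n)))" for n
      using gb by (intro integrable_quad_decay quad_decay_mult_bounded[OF f]) auto
    show "AE x in lborel. summable (\<lambda>n. norm (f x * g (x + of_int (int_decode n))))"
      using summable_mult[OF summable_periodize(1)[OF g]] by (simp add: abs_mult)
    show "summable (\<lambda>n. \<integral>x. norm (f x * g (x + of_int (int_decode n))) \<partial>lborel)"
    proof (rule summableI_nonneg_bounded)
      fix N
      have "(\<Sum>n<N. \<integral>x. norm (f x * g (x + of_int (int_decode n))) \<partial>lborel)
          = (\<integral>x. (\<Sum>n<N. norm (f x * g (x + of_int (int_decode n)))) \<partial>lborel)"
        using i by (intro Bochner_Integration.integral_sum[symmetric] integrable_norm) auto
      also have "\<dots> \<le> (\<integral>x. \<bar>f x\<bar> * K \<partial>lborel)"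
      proof (rule integral_mono)
        show "integrable lborel (\<lambda>x. \<Sum>n<N. norm (f x * g (x + of_int (int_decode n))))"
          using i by (intro Bochner_Integration.integrable_sum integrable_norm) auto
        show "integrable lborel (\<lambda>x. \<bar>f x\<bar> * K)" using integrable_quad_decay[OF f] by simp
        show "(\<Sum>n<N. norm (f x * g (x + of_int (int_decode n)))) \<le> \<bar>f x\<bar> * K" for x
          using K(3)[where x = x and N = N] by (simp add: abs_mult sum_distrib_left[symmetric] mult_left_mono)
      qed
      finally show "(\<Sum>n<N. \<integral>x. norm (f x * g (x + of_int (int_decode n))) \<partial>lborel) \<le> (\<integral>x. \<bar>f x\<bar> * K \<partial>lborel)" .
    qed simp
  qed
  also have "\<dots> = (\<Sum>n. if int_decode n = 0 then v else 0)" by (simp add: orth)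
  also have "\<dots> = (\<Sum>n::nat. if n = 0 then v else 0)"
  proof -
    have "int_decode n = 0 \<longleftrightarrow> n = 0" for n
      by (metis int_decode_inverse int_encode_inverse int_encode_eq int_decode_def sum_decode_def
          even_zero div_0 int_ops(1) old.sum.simps(5))
    thus ?thesis by simp
  qed
  also have "\<dots> = v" using sums_single[of 0 "\<lambda>_. v"] by (simp add: sums_iff)
  finally show ?thesis .
qed

text \<open>Since 2^j is at least 1, the dilation only improves the decay, and the shift by m is
  absorbed by Peetre's inequality.\<close>

lemma quad_decay_dilate:
  assumes "quad_decay f"
  shows "quad_decay (dilate f j m)"
proof -
  have [measurable]: "f \<in> borel_measurable borel" using assms by (auto simp: quad_decay_def)
  obtain C where C: "0 \<le> C" "\<And>x. \<bar>f x\<bar> \<le> C / (1 + x\<^sup>2)"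
    using quad_decay_bound[OF assms] by blast
  define D where "D = 2 powr (real j / 2) * (C * (2 + 2 * (real_of_int m)\<^sup>2))"
  have "\<bar>dilate f j m x\<bar> \<le> D / (1 + x\<^sup>2)" for x
  proof -
    define y where "y = 2 ^ j * x - of_int m"
    have "1 + x\<^sup>2 \<le> 1 + (2 ^ j * x)\<^sup>2"
      using mult_right_mono[of 1 "(2 ^ j)\<^sup>2" "x\<^sup>2"] by (simp add: power_mult_distrib one_le_power)
    also have "\<dots> = 1 + (y + of_int m)\<^sup>2" by (simp add: y_def)
    also have "\<dots> \<le> (2 + 2 * (real_of_int m)\<^sup>2) * (1 + y\<^sup>2)"
    proof -
      have "0 \<le> (y - real_of_int m)\<^sup>2 + 1 + 2 * (real_of_int m)\<^sup>2 * y\<^sup>2" by simp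
      thus ?thesis by (simp add: power2_eq_square algebra_simps)
    qed
    finally have "1 / (1 + y\<^sup>2) \<le> (2 + 2 * (real_of_int m)\<^sup>2) / (1 + x\<^sup>2)"
      by (simp add: divide_simps add_pos_nonneg)
    hence "C * (1 / (1 + y\<^sup>2)) \<le> C * ((2 + 2 * (real_of_int m)\<^sup>2) / (1 + x\<^sup>2))"
      using C(1) by (rule mult_left_mono)
    with C(2)[of y] have "\<bar>f y\<bar> \<le> C * ((2 + 2 * (real_of_int m)\<^sup>2) / (1 + x\<^sup>2))" by simp
    hence "2 powr (real j / 2) * \<bar>f y\<bar> \<le> 2 powr (real j / 2) * (C * ((2 + 2 * (real_of_int m)\<^sup>2) / (1 + x\<^sup>2)))"
      by (rule mult_left_mono) simp
    thus ?thesis by (simp add: dilate_def abs_mult D_def y_def)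
  qed
  moreover have "dilate f j m \<in> borel_measurable borel" unfolding dilate_def by measurable
  ultimately show ?thesis by (auto simp: quad_decay_def)
qed

section \<open>Orthonormality of periodic wavelets\<close>

text \<open>Substituting 2^j x for x lowers both levels by j; the normalising factors that remain
  are those of levels 0 and j' - j.\<close>

lemma integral_dilate_dilate:
  assumes j: "j \<le> j'" and [measurable]: "f \<in> borel_measurable borel" "g \<in> borel_measurable borel"
  shows "(\<integral>x. dilate f j m x * dilate g j' m' x \<partial>lborel)
       = (\<integral>x. dilate f 0 m x * dilate g (j' - j) m' x \<partial>lborel)"
proof -
  have [measurable]: "dilate f i k \<in> borel_measurable borel" "dilate g i k \<in> borel_measurable borel" for i k
    unfolding dilate_def by measurable
  have pj: "(2::real) ^ j' = 2 ^ j * 2 ^ (j' - j)" using j by (simp flip: power_add)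
  have "real j / 2 + real j' / 2 = real j + real (j' - j) / 2"
    using j by (simp add: of_nat_diff field_simps)
  hence "(2::real) powr (real j / 2) * 2 powr (real j' / 2) = 2 powr real j * 2 powr (real (j' - j) / 2)"
    by (simp only: powr_add[symmetric])
  hence c: "2 powr (real j / 2) * 2 powr (real j' / 2) = 2 ^ j * 2 powr (real (j' - j) / 2)"
    by (simp add: powr_realpow)
  have pt: "dilate f j m x * dilate g j' m' x
      = 2 ^ j * (dilate f 0 m (2 ^ j * x) * dilate g (j' - j) m' (2 ^ j * x))" for x
  proof -
    have "dilate f j m x * dilate g j' m' x =
       (2 powr (real j / 2) * 2 powr (real j' / 2)) * (f (2 ^ j * x - of_int m) * g (2 ^ j' * x - of_int m'))"
      by (simp add: dilate_def mult_ac)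
    thus ?thesis unfolding c by (simp add: dilate_def pj mult_ac)
  qed
  have "(\<integral>x. dilate f 0 m x * dilate g (j' - j) m' x \<partial>lborel)
      = (\<integral>x. 2 ^ j * (dilate f 0 m (2 ^ j * x) * dilate g (j' - j) m' (2 ^ j * x)) \<partial>lborel)"
    by (subst lborel_integral_real_affine[of "2 ^ j" _ 0]) auto
  thus ?thesis by (simp only: pt)
qed

text \<open>\<open>line_index\<close> admits \<open>F_type\<close> at level 0 only, but in several
  variables \<open>F_type\<close> factors occur at every level. Rescaling moves the coarser function
  to level 0, where both types are allowed; the finer one then sits at level 0 too or is a
  wavelet.\<close>

lemma line_orthonormal:
  assumes "orthonormal_wavelet_system \<psi>"
    and "j \<le> j'" "j < j' \<Longrightarrow> g' = M_type"
  shows "(\<integral>x. dilate (\<psi> g) j m x * dilate (\<psi> g') j' m' x \<partial>lborel)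
       = (if (g, j, m) = (g', j', m') then 1 else 0)"
proof -
  have m: "\<psi> g \<in> borel_measurable borel" for g
    using assms(1) by (auto simp: orthonormal_wavelet_system_def square_integrable_def)
  have "(g, 0, m) \<in> line_index" "(g', j' - j, m') \<in> line_index"
    using assms(2,3) by (cases "j < j'"; auto simp: line_index_def)+
  note ix = this
  have all: "\<forall>(g, j, m)\<in>line_index. \<forall>(g', j', m')\<in>line_index.
        (\<integral>x. dilate (\<psi> g) j m x * dilate (\<psi> g') j' m' x \<partial>lborel)
          = (if (g, j, m) = (g', j', m') then 1 else 0)"
    using assms(1) unfolding orthonormal_wavelet_system_def by (elim conjE)
  have ix': "\<forall>(g', j', m')\<in>line_index.
        (\<integral>x. dilate (\<psi> g) 0 m x * dilate (\<psi> g') j' m' x \<partial>lborel)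
          = (if (g, 0, m) = (g', j', m') then 1 else 0)"
    using bspec[OF all ix(1)] by (simp only: prod.case)
  have "(\<integral>x. dilate (\<psi> g) 0 m x * dilate (\<psi> g') (j' - j) m' x \<partial>lborel)
          = (if (g, 0, m) = (g', j' - j, m') then 1 else 0)"
    using bspec[OF ix' ix(2)] by (simp only: prod.case)
  thus ?thesis using integral_dilate_dilate[OF assms(2) m m] assms(2) by auto
qed

lemma dilate_shift: "dilate f j m (x + of_int k) = dilate f j (m - 2 ^ j * k) x"
  by (simp add: dilate_def algebra_simps)

text \<open>A translate by k of a dilated function is the member of the same family with index
  shifted by 2^j' k. At equal levels both indices lie in [0, 2^j), so a match forces k = 0.\<close>

lemma periodized_orthonormal:
  assumes "orthonormal_wavelet_system \<psi>" "\<And>g. quad_decay (\<psi> g)"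
    and "j \<le> j'" "j < j' \<Longrightarrow> g' = M_type" "0 \<le> m" "m < 2 ^ j" "0 \<le> m'" "m' < 2 ^ j'"
  shows "(\<integral>x. indicator {0..<1} x * (periodize (dilate (\<psi> g) j m) x * periodize (dilate (\<psi> g') j' m') x) \<partial>lborel)
       = (if (g, j, m) = (g', j', m') then 1 else 0)"
proof (rule integral_periodize_periodize)
  show "quad_decay (dilate (\<psi> g) j m)" "quad_decay (dilate (\<psi> g') j' m')"
    by (intro quad_decay_dilate assms)+
  fix k :: int
  have k: "k = 0" if "j = j'" "m = m' - 2 ^ j' * k"
  proof -
    have "\<bar>2 ^ j' * k\<bar> < 2 ^ j'" using that assms(5-8) by auto
    hence "2 ^ j' * \<bar>k\<bar> < 2 ^ j' * 1" by (simp add: abs_mult)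
    hence "\<bar>k\<bar> < 1" by (subst (asm) mult_less_cancel_left_pos) auto
    thus ?thesis by simp
  qed
  show "(\<integral>x. dilate (\<psi> g) j m x * dilate (\<psi> g') j' m' (x + of_int k) \<partial>lborel)
     = (if k = 0 then if (g, j, m) = (g', j', m') then 1 else 0 else 0)"
  proof -
    have "(\<integral>x. dilate (\<psi> g) j m x * dilate (\<psi> g') j' m' (x + of_int k) \<partial>lborel)
        = (if (g, j, m) = (g', j', m' - 2 ^ j' * k) then 1 else 0)"
      unfolding dilate_shift by (rule line_orthonormal) (use assms(1,3,4) in auto)
    thus ?thesis using k by auto
  qed
qed

section \<open>Decay of the Meyer and Daubechies generators\<close>

lemma quad_decay_compact_support:
  assumes "continuous_on UNIV f" "\<And>x. R < \<bar>x\<bar> \<Longrightarrow> f x = 0"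
  shows "quad_decay f"
proof -
  have "compact ((\<lambda>x. \<bar>f x\<bar> * (1 + x\<^sup>2)) ` {-R..R})"
    by (intro compact_continuous_image continuous_intros continuous_on_subset[OF assms(1)]) auto
  then obtain C where "\<forall>y\<in>(\<lambda>x. \<bar>f x\<bar> * (1 + x\<^sup>2)) ` {-R..R}. norm y \<le> C"
    using compact_imp_bounded bounded_iff by metis
  hence C: "\<And>x. x \<in> {-R..R} \<Longrightarrow> \<bar>\<bar>f x\<bar> * (1 + x\<^sup>2)\<bar> \<le> C"
    by simp
  \<comment> \<open>The maximum with 0 covers negative R, where the interval is empty and C is
    arbitrary.\<close>
  have "\<bar>f x\<bar> \<le> max C 0 / (1 + x\<^sup>2)" for x
  proof (cases "x \<in> {-R..R}")
    case True
    have "\<bar>f x\<bar> * (1 + x\<^sup>2) \<le> max C 0" using C[OF True] by linarith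
    thus ?thesis by (subst pos_le_divide_eq) (auto simp: add_pos_nonneg)
  next
    case False
    hence "f x = 0" by (intro assms(2)) auto
    thus ?thesis by simp
  qed
  thus ?thesis using borel_measurable_continuous_onI[OF assms(1)] by (auto simp: quad_decay_def)
qed

lemma quad_decay_schwartz:
  assumes "schwartz_fun f"
  shows "quad_decay f"
proof -
  have d: "f differentiable (at x)" and "bounded (range (\<lambda>x. x ^ N * f x))" for x N
    using assms[unfolded schwartz_fun_def, rule_format, of 0] by auto
  from this(2)[of 0] this(2)[of 2] obtain A B where A: "\<And>x. \<bar>f x\<bar> \<le> A" and B: "\<And>x. \<bar>x\<^sup>2 * f x\<bar> \<le> B"
    by (auto simp: bounded_iff)
  have "\<bar>f x\<bar> \<le> (A + B) / (1 + x\<^sup>2)" for x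
  proof -
    have "\<bar>f x\<bar> * (1 + x\<^sup>2) \<le> A + B" using A[of x] B[of x] by (simp add: abs_mult algebra_simps)
    thus ?thesis by (subst pos_le_divide_eq) (auto simp: add_pos_nonneg)
  qed
  moreover have "continuous_on UNIV f"
    using d by (auto intro!: continuous_at_imp_continuous_on differentiable_imp_continuous_within)
  ultimately show ?thesis using borel_measurable_continuous_onI by (auto simp: quad_decay_def)
qed

lemma admissible_system_quad_decay:
  assumes "admissible_system S \<psi>"
  shows "quad_decay (\<psi> g)" and "orthonormal_wavelet_system \<psi>"
proof -
  show "orthonormal_wavelet_system \<psi>"
    using assms by (auto simp: admissible_system_def meyer_system_def daubechies_system_def)
  show "quad_decay (\<psi> g)"
    using assms unfolding admissible_system_def
  proof (elim disjE exE conjE)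
    assume "meyer_system \<psi>"
    thus ?thesis by (auto simp: meyer_system_def intro: quad_decay_schwartz)
  next
    fix k assume D: "daubechies_system k \<psi>"
    then obtain R where R: "\<And>x. R < \<bar>x\<bar> \<Longrightarrow> \<psi> g x = 0"
      unfolding daubechies_system_def by blast
    have C: "Ck_fun k (\<psi> g)" using D by (auto simp: daubechies_system_def)
    have "continuous_on UNIV (\<psi> g)"
    \<comment> \<open>For k = 0 continuity is the second clause of \<open>Ck_fun\<close>; otherwise
      the first clause at order 0 gives differentiability.\<close>
    proof (cases k)
      case 0
      with C show ?thesis by (simp add: Ck_fun_def)
    next
      case (Suc k')
      hence "\<psi> g differentiable (at x)" for x
        using C[unfolded Ck_fun_def, THEN conjunct1, rule_format, of 0] by simp
      thus ?thesis
        by (auto intro!: continuous_at_imp_continuous_on differentiable_imp_continuous_within)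
    qed
    thus ?thesis using R by (rule quad_decay_compact_support)
  qed
qed

section \<open>Product integrals and orthonormality in several variables\<close>

lemma Basis_vec_eq_axis: "(Basis :: (real^'n) set) = (\<lambda>i. axis i 1) ` UNIV"
  by (auto simp: Basis_vec_def)

text \<open>Fubini: Lebesgue measure on the vector space is the image of the product of
  one-dimensional Lebesgue measures indexed by \<open>Basis\<close>, so the coordinates have to be
  relabelled by unit vectors.\<close>

lemma integral_lborel_vec_prod:
  fixes f :: "'n::finite \<Rightarrow> real \<Rightarrow> real"
  assumes "\<And>i. integrable lborel (f i)"
  shows "(\<integral>x. (\<Prod>i\<in>UNIV. f i (x $ i)) \<partial>(lborel :: (real^'n) measure)) = (\<Prod>i\<in>UNIV. \<integral>x. f i x \<partial>lborel)"
proof -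
  interpret product_sigma_finite "\<lambda>_::real^'n. lborel :: real measure"
    by (simp add: product_sigma_finite_def sigma_finite_lborel)
  have [measurable]: "f i \<in> borel_measurable borel" for i using assms[of i] by auto
  have inj: "inj (\<lambda>i::'n. axis i (1::real))" by (auto simp: inj_def axis_eq_axis)
  \<comment> \<open>Carries the factors from coordinates over to unit vectors; the description
    inverts the injective map \<open>axis\<close>.\<close>
  define g where "g b = f (THE i. b = axis i (1::real))" for b :: "real^'n"
  have g: "g (axis i 1) = f i" for i by (simp add: g_def axis_eq_axis)
  have "(\<integral>x. (\<Prod>i\<in>UNIV. f i (x $ i)) \<partial>(lborel :: (real^'n) measure))
      = (\<integral>x. (\<Prod>b\<in>Basis. g b (x \<bullet> b)) \<partial>(lborel :: (real^'n) measure))"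
    unfolding Basis_vec_eq_axis prod.reindex[OF inj] by (simp add: g inner_axis)
  also have "\<dots> = (\<integral>y. (\<Prod>b\<in>Basis. g b ((\<Sum>b\<in>Basis. y b *\<^sub>R b) \<bullet> b)) \<partial>(\<Pi>\<^sub>M b\<in>Basis. lborel))"
  proof (subst lborel_eq, rule integral_distr)
    have "g b \<in> borel_measurable borel" if "b \<in> Basis" for b
      using that g by (auto simp: Basis_vec_eq_axis)
    thus "(\<lambda>x. \<Prod>b\<in>Basis. g b (x \<bullet> b)) \<in> borel_measurable borel" by (intro borel_measurable_prod) auto
  qed measurable
  also have "\<dots> = (\<integral>y. (\<Prod>b\<in>Basis. g b (y b)) \<partial>(\<Pi>\<^sub>M b\<in>(Basis::(real^'n) set). lborel))"
    by (intro Bochner_Integration.integral_cong prod.cong) (auto simp: inner_sum_left_Basis)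
  also have "\<dots> = (\<Prod>b\<in>(Basis::(real^'n) set). \<integral>x. g b x \<partial>lborel)"
    by (rule product_integral_prod) (use assms g in \<open>auto simp: Basis_vec_eq_axis\<close>)
  also have "\<dots> = (\<Prod>i\<in>UNIV. \<integral>x. f i x \<partial>lborel)"
    unfolding Basis_vec_eq_axis prod.reindex[OF inj] by (simp add: g)
  finally show ?thesis .
qed

lemma torus_integral_prod:
  fixes f :: "'n::finite \<Rightarrow> real \<Rightarrow> real"
  assumes "\<And>i. integrable lborel (\<lambda>x. indicator {0..<1} x * f i x)"
  shows "(\<integral>x. (\<Prod>i\<in>UNIV. f i (x $ i)) \<partial>torus_measure) = (\<Prod>i\<in>UNIV. \<integral>x. indicator {0..<1} x * f i x \<partial>lborel)"
proof -
  have "(\<integral>x. (\<Prod>i\<in>UNIV. f i (x $ i)) \<partial>(torus_measure :: (real^'n) measure))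
      = (\<integral>x. indicator {x. \<forall>i. 0 \<le> x $ i \<and> x $ i < 1} x *\<^sub>R (\<Prod>i\<in>UNIV. f i (x $ i)) \<partial>lborel)"
    unfolding torus_measure_def by (rule integral_restrict_space) simp
  also have "\<dots> = (\<integral>x. (\<Prod>i\<in>UNIV. indicator {0..<1} (x $ i) * f i (x $ i)) \<partial>(lborel :: (real^'n) measure))"
    by (intro Bochner_Integration.integral_cong) (auto simp: indicator_def prod.distrib)
  also have "\<dots> = (\<Prod>i\<in>UNIV. \<integral>x. indicator {0..<1} x * f i x \<partial>lborel)"
    by (rule integral_lborel_vec_prod) (rule assms)
  finally show ?thesis .
qed

lemma periodic_wavelet_eq:
  "periodic_wavelet \<psi> j G m x = (\<Prod>i\<in>UNIV. periodize (dilate (\<psi> (G $ i)) j (int (m $ i))) (x $ i))"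
  by (simp add: periodic_wavelet_def periodize_def dilate_def)

text \<open>The inner product factorises over the coordinates. At equal levels each factor is a
  Kronecker delta. At different levels one coordinate in which the finer function is a wavelet makes
  the product vanish, and the other factors are left unevaluated.\<close>

lemma periodic_wavelet_orthonormal_le:
  fixes G :: "gender^'n" and m :: "nat^'n"
  assumes "orthonormal_wavelet_system \<psi>" "\<And>g. quad_decay (\<psi> g)"
    and "(j, G, m) \<in> wavelet_index" "(j', G', m') \<in> wavelet_index" "j \<le> j'"
  shows "torus_inner (periodic_wavelet \<psi> j G m) (periodic_wavelet \<psi> j' G' m')
    = (if (j, G, m) = (j', G', m') then 1 else 0)"
proof -
  define a where "a i = periodize (dilate (\<psi> (G $ i)) j (int (m $ i)))" for i
  define b where "b i = periodize (dilate (\<psi> (G' $ i)) j' (int (m' $ i)))" for i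
  have q: "quad_decay (dilate (\<psi> (G $ i)) j (int (m $ i)))" "quad_decay (dilate (\<psi> (G' $ i)) j' (int (m' $ i)))" for i
    by (intro quad_decay_dilate assms)+
  have int: "integrable lborel (\<lambda>x. indicator {0..<1} x * (a i x * b i x))" for i
  proof -
    obtain A where A: "0 \<le> A" "\<And>x. \<bar>a i x\<bar> \<le> A" using periodize_bounded[OF q(1)[of i]] unfolding a_def by metis
    obtain B where B: "0 \<le> B" "\<And>x. \<bar>b i x\<bar> \<le> B" using periodize_bounded[OF q(2)[of i]] unfolding b_def by metis
    have [measurable]: "a i \<in> borel_measurable borel" "b i \<in> borel_measurable borel"
      using periodize_measurable q by (auto simp: a_def b_def)
    show ?thesis
    proof (rule Bochner_Integration.integrable_bound)
      show "integrable lborel (\<lambda>x. indicator {0..<1::real} x * (A * B))" by simp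
      show "AE x in lborel. norm (indicator {0..<1} x * (a i x * b i x)) \<le> norm (indicator {0..<1::real} x * (A * B))"
      proof (intro AE_I2)
        fix x :: real
        have "\<bar>a i x\<bar> * \<bar>b i x\<bar> \<le> A * B" by (intro mult_mono A B) auto
        thus "norm (indicator {0..<1} x * (a i x * b i x)) \<le> norm (indicator {0..<1::real} x * (A * B))"
          using A(1) B(1) by (simp add: indicator_def abs_mult)
      qed
    qed measurable
  qed
  have "torus_inner (periodic_wavelet \<psi> j G m) (periodic_wavelet \<psi> j' G' m')
      = (\<integral>x. (\<Prod>i\<in>UNIV. a i (x $ i) * b i (x $ i)) \<partial>torus_measure)"
    by (simp add: torus_inner_def periodic_wavelet_eq a_def b_def prod.distrib)
  also have "\<dots> = (\<Prod>i\<in>UNIV. \<integral>x. indicator {0..<1} x * (a i x * b i x) \<partial>lborel)"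
    by (rule torus_integral_prod) (rule int)
  finally have eq: "torus_inner (periodic_wavelet \<psi> j G m) (periodic_wavelet \<psi> j' G' m')
      = (\<Prod>i\<in>UNIV. \<integral>x. indicator {0..<1} x * (a i x * b i x) \<partial>lborel)" .
  have m: "m $ i < 2 ^ j" "m' $ i < 2 ^ j'" for i
    using assms(3,4) by (auto simp: wavelet_index_def M_level_def)
  have m: "int (m $ i) < 2 ^ j" "int (m' $ i) < 2 ^ j'" for i
    using m[of i] by simp_all
  have fac: "(\<integral>x. indicator {0..<1} x * (a i x * b i x) \<partial>lborel)
      = (if (G $ i, j, int (m $ i)) = (G' $ i, j', int (m' $ i)) then 1 else 0)"
    if "j < j' \<Longrightarrow> G' $ i = M_type" for i
    unfolding a_def b_def using that m by (intro periodized_orthonormal assms) auto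
  show ?thesis
  proof (cases "j = j'")
    case True
    have "(\<integral>x. indicator {0..<1} x * (a i x * b i x) \<partial>lborel)
        = (if G $ i = G' $ i \<and> m $ i = m' $ i then 1 else 0)" for i
      using fac[of i] True by simp
    hence "torus_inner (periodic_wavelet \<psi> j G m) (periodic_wavelet \<psi> j' G' m')
      = (\<Prod>i\<in>UNIV. if G $ i = G' $ i \<and> m $ i = m' $ i then 1 else 0)"
      unfolding eq by simp
    also have "\<dots> = (if G = G' \<and> m = m' then 1 else 0)"
    proof (cases "G = G' \<and> m = m'")
      case False
      then obtain i where "\<not> (G $ i = G' $ i \<and> m $ i = m' $ i)" by (auto simp: vec_eq_iff)
      hence "(\<Prod>i\<in>UNIV. if G $ i = G' $ i \<and> m $ i = m' $ i then 1 else 0 :: real) = 0"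
        by (intro prod_zero bexI[of _ i]) auto
      thus ?thesis using False by simp
    qed simp
    finally show ?thesis using True by simp
  next
    case False
    hence "j < j'" using assms(5) by simp
    \<comment> \<open>The finer level is positive, so \<open>G_level\<close> forces an entry
      \<open>M_type\<close>.\<close>
    then obtain i where "G' $ i = M_type" using assms(4) by (auto simp: wavelet_index_def G_level_def)
    with fac[of i] False have "(\<integral>x. indicator {0..<1} x * (a i x * b i x) \<partial>lborel) = 0" by simp
    hence "(\<Prod>i\<in>UNIV. \<integral>x. indicator {0..<1} x * (a i x * b i x) \<partial>lborel) = 0"
      by (intro prod_zero bexI[of _ i]) auto
    thus ?thesis unfolding eq using False by simp
  qed
qed

lemma periodic_wavelet_orthonormal:
  fixes G :: "gender^'n" and m :: "nat^'n"
  assumes "orthonormal_wavelet_system \<psi>" "\<And>g. quad_decay (\<psi> g)"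
    and "(j, G, m) \<in> wavelet_index" "(j', G', m') \<in> wavelet_index"
  shows "torus_inner (periodic_wavelet \<psi> j G m) (periodic_wavelet \<psi> j' G' m')
    = (if (j, G, m) = (j', G', m') then 1 else 0)"
proof (cases "j \<le> j'")
  case True
  thus ?thesis by (rule periodic_wavelet_orthonormal_le[OF assms])
next
  case False
  have "torus_inner (periodic_wavelet \<psi> j G m) (periodic_wavelet \<psi> j' G' m')
    = torus_inner (periodic_wavelet \<psi> j' G' m') (periodic_wavelet \<psi> j G m)"
    by (simp add: torus_inner_def mult.commute)
  also have "\<dots> = (if (j', G', m') = (j, G, m) then 1 else 0)"
    using False by (intro periodic_wavelet_orthonormal_le[OF assms(1,2,4,3)]) auto
  finally show ?thesis by auto
qed

section \<open>Finite index sets and recovery of the coefficients\<close>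

lemma UNIV_gender: "UNIV = {F_type, M_type}"
  using gender.exhaust by auto

text \<open>Makes \<open>gender^'n\<close> finite, so that the sums over \<open>G_level\<close> are
  genuine; a sum over an infinite set would be 0 by default.\<close>

instance gender :: finite
  by standard (simp add: UNIV_gender)

lemma M_level_eq: "(M_level j :: (nat^'n) set) = vec_lambda ` (UNIV \<rightarrow>\<^sub>E {..<2 ^ j})"
proof -
  have "m \<in> vec_lambda ` (UNIV \<rightarrow>\<^sub>E {..<2 ^ j})" if "m \<in> M_level j" for m :: "nat^'n"
    using that by (intro image_eqI[of _ _ "vec_nth m"]) (auto simp: M_level_def)
  thus ?thesis by (auto simp: M_level_def)
qed

lemma finite_M_level [simp]: "finite (M_level j :: (nat^'n) set)"
  unfolding M_level_eq by (intro finite_imageI finite_PiE) auto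

lemma card_M_level: "card (M_level j :: (nat^'n) set) = 2 ^ (j * CARD('n))"
proof -
  have "inj_on vec_lambda (UNIV \<rightarrow>\<^sub>E {..<2 ^ j} :: ('n \<Rightarrow> nat) set)"
    by (auto intro!: inj_onI simp: vec_lambda_inject)
  thus ?thesis unfolding M_level_eq by (simp add: card_image card_PiE power_mult)
qed

text \<open>Pairing with a single wavelet keeps one term of the series by orthonormality, so the sum
  over levels is finite whatever the growth of a.\<close>

lemma wavelet_coeff_wavelet_series:
  fixes G :: "gender^'n" and m :: "nat^'n"
  assumes "orthonormal_wavelet_system \<psi>" "\<And>g. quad_decay (\<psi> g)"
    and i: "(j, G, m) \<in> wavelet_index"
  shows "wavelet_coeff \<psi> (wavelet_series \<psi> a) j G m = 2 powr (real j * real CARD('n) / 2) * a j G m"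
proof -
  have GM: "G \<in> G_level j" "m \<in> M_level j" using i by (auto simp: wavelet_index_def)
  define T where "T j' = (\<Sum>G'\<in>G_level j'. \<Sum>m'\<in>M_level j'.
     a j' G' m' * torus_inner (periodic_wavelet \<psi> j' G' m') (periodic_wavelet \<psi> j G m))" for j'
  have T': "T j' = (\<Sum>G'\<in>G_level j'. \<Sum>m'\<in>M_level j'. if j' = j \<and> G' = G \<and> m' = m then a j G m else 0)" for j'
    unfolding T_def
  proof (intro sum.cong refl)
    fix G' :: "gender^'n" and m' :: "nat^'n" assume "G' \<in> G_level j'" "m' \<in> M_level j'"
    hence "(j', G', m') \<in> wavelet_index" by (simp add: wavelet_index_def)
    from periodic_wavelet_orthonormal[OF assms(1,2) this i]
    show "a j' G' m' * torus_inner (periodic_wavelet \<psi> j' G' m') (periodic_wavelet \<psi> j G m)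
      = (if j' = j \<and> G' = G \<and> m' = m then a j G m else 0)" by auto
  qed
  have Tj: "T j = a j G m"
  proof -
    have "T j = (\<Sum>G'\<in>G_level j. if G' = G then \<Sum>m'\<in>M_level j. if m' = m then a j G m else 0 else 0)"
      unfolding T' by (intro sum.cong) auto
    thus ?thesis using GM by simp
  qed
  have "wavelet_series \<psi> a (periodic_wavelet \<psi> j G m) = (\<Sum>j'. T j')"
    by (simp add: wavelet_series_def T_def)
  also have "\<dots> = sum T {j}"
    by (rule suminf_finite) (auto simp: T')
  finally show ?thesis by (simp add: wavelet_coeff_def Tj)
qed

section \<open>The torus\<close>

text \<open>A nonzero lattice vector has norm at least 1, so shifting x by it leaves a norm greater
  than 1/2.\<close>

lemma torus_norm_eq_norm:
  fixes x :: "real^'n"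
  assumes "norm x < 1 / 2"
  shows "torus_norm x = norm x"
  unfolding torus_norm_def
proof (rule antisym)
  have bdd: "bdd_below ((\<lambda>k. norm (x + k)) ` int_lattice)" by (rule bdd_belowI2[of _ 0]) simp
  have z: "0 \<in> (int_lattice :: (real^'n) set)" by (simp add: int_lattice_def)
  show "(INF k\<in>int_lattice. norm (x + k)) \<le> norm x" using cINF_lower[OF bdd z] by simp
  show "norm x \<le> (INF k\<in>int_lattice. norm (x + k))"
  proof (rule cINF_greatest)
    show "(int_lattice :: (real^'n) set) \<noteq> {}" using z by blast
    fix k :: "real^'n" assume k: "k \<in> int_lattice"
    show "norm x \<le> norm (x + k)"
    proof (cases "k = 0")
      case False
      then obtain i where "k $ i \<noteq> 0" by (auto simp: vec_eq_iff)
      moreover have "k $ i \<in> \<int>" using k by (simp add: int_lattice_def)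
      ultimately have "1 \<le> \<bar>k $ i\<bar>" by (auto elim!: Ints_cases)
      also have "\<dots> \<le> norm k" by (rule component_le_norm_cart)
      finally have "1 \<le> norm k" .
      moreover have "norm k \<le> norm (x + k) + norm x"
        using norm_triangle_ineq4[of "x + k" x] by simp
      ultimately show ?thesis using assms by linarith
    qed simp
  qed
qed

lemma C_log_loc_continuous:
  fixes g :: "real^'n \<Rightarrow> real"
  assumes "C_log_loc g"
  shows "continuous_on UNIV g"
proof -
  obtain c where c: "c > 0" "\<And>x y. \<bar>g x - g y\<bar> \<le> c / ln (exp 1 + 1 / torus_norm (x - y))"
    using assms by (auto simp: C_log_loc_def)
  show ?thesis
    unfolding continuous_on_iff
  proof (intro ballI allI impI)
    fix x :: "real^'n" and e :: real assume e: "0 < e"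
    \<comment> \<open>The bound 1/2 makes the torus norm Euclidean; the second bound makes the
      logarithm exceed c / e.\<close>
    define d where "d = min (1 / 2) (1 / exp (c / e))"
    show "\<exists>d>0. \<forall>x'\<in>UNIV. dist x' x < d \<longrightarrow> dist (g x') (g x) < e"
    proof (intro exI[of _ d] conjI ballI impI)
      show "0 < d" by (simp add: d_def)
      fix y assume y: "dist y x < d"
      show "dist (g y) (g x) < e"
      \<comment> \<open>At distance 0 the quotient 1 / 0 is 0 and the bound takes the value c, which
        need not be small, so y = x is treated apart.\<close>
      proof (cases "y = x")
        case False
        hence pos: "0 < norm (y - x)" by simp
        have lt: "norm (y - x) < 1 / 2" "norm (y - x) < 1 / exp (c / e)"
          using y by (auto simp: d_def dist_norm)
        have "exp (c / e) < 1 / norm (y - x)"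
          using lt(2) pos by (simp add: field_simps)
        also have "\<dots> < exp 1 + 1 / norm (y - x)" by simp
        finally have "exp (c / e) < exp 1 + 1 / norm (y - x)" .
        hence "ln (exp (c / e)) < ln (exp 1 + 1 / norm (y - x))"
          by (subst ln_less_cancel_iff) (auto intro: add_pos_nonneg)
        hence "c / e < ln (exp 1 + 1 / norm (y - x))" by simp
        moreover from this have "0 < ln (exp 1 + 1 / norm (y - x))"
          using c(1) e by (meson divide_pos_pos less_trans)
        ultimately have "c / ln (exp 1 + 1 / norm (y - x)) < e"
          using e by (simp add: field_simps)
        with c(2)[of y x] show ?thesis
          by (simp add: torus_norm_eq_norm[OF lt(1)] dist_real_def)
      qed (use e in simp)
    qed
  qed
qed

text \<open>Fractional parts of the coordinates move every point into the unit cube; the closed cube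
  is taken for its compactness.\<close>

lemma torus_fun_range:
  fixes g :: "real^'n \<Rightarrow> real"
  assumes "torus_fun g"
  shows "range g = g ` cbox 0 1"
proof -
  have "g x \<in> g ` cbox 0 1" for x
  proof -
    define y where "y = (\<chi> i. frac (x $ i))"
    define k where "k = (\<chi> i. real_of_int \<lfloor>x $ i\<rfloor>)"
    have "x = y + k" by (simp add: y_def k_def vec_eq_iff frac_def)
    moreover have "k \<in> int_lattice" by (simp add: k_def int_lattice_def)
    ultimately have "g x = g y" using assms by (simp add: torus_fun_def)
    moreover have "y \<in> cbox 0 1"
      by (simp add: y_def mem_box_cart frac_lt_1 less_imp_le)
    ultimately show ?thesis by blast
  qed
  thus ?thesis by blast
qed

text \<open>By periodicity r has compact range and attains its maximum, whose sign decides the case: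
  a negative maximum is a uniform negative bound, and a positive one excludes negative values
  because the range is connected and misses 0.\<close>

lemma torus_sign_dichotomy:
  fixes r :: "real^'n \<Rightarrow> real"
  assumes "torus_fun r" and cont: "continuous_on UNIV r" and nz: "\<And>x. r x \<noteq> 0"
  shows "(\<exists>c>0. \<forall>x. r x \<le> - c) \<and> (SUP x. r x) < 0 \<or> (\<forall>x. 0 < r x) \<and> \<not> (SUP x. r x) < 0"
proof -
  have "compact (range r)" unfolding torus_fun_range[OF assms(1)]
    by (intro compact_continuous_image continuous_on_subset[OF cont]) auto
  from compact_attains_sup[OF this] obtain z where z: "\<And>x. r x \<le> r z" by auto
  have bdd: "bdd_above (range r)" using z by (intro bdd_aboveI2[of _ _ "r z"]) auto
  consider "r z < 0" | "0 < r z" using nz[of z] by linarith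
  thus ?thesis
  proof cases
    case 1
    have "(SUP x. r x) \<le> r z" using z by (intro cSUP_least) auto
    with 1 have "(SUP x. r x) < 0" by simp
    thus ?thesis using 1 z by (intro disjI1 conjI exI[of _ "- r z"]) auto
  next
    case 2
    have "r z \<le> (SUP x. r x)" by (rule cSUP_upper[OF _ bdd]) simp
    with 2 have "\<not> (SUP x. r x) < 0" by linarith
    moreover have "0 < r x" for x
    proof (rule ccontr)
      assume n: "\<not> 0 < r x"
      have "connected (range r)" by (intro connected_continuous_image cont connected_UNIV)
      from connected_contains_Icc[OF this, of "r x" "r z"] n 2 have "0 \<in> range r" by (simp add: subset_iff)
      thus False using nz by (metis imageE)
    qed
    ultimately show ?thesis by blast
  qed
qed

section \<open>Measure of boxes and dyadic cubes\<close>

lemma halfopen_box_measure: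
  fixes a b :: "'n::finite \<Rightarrow> real"
  assumes ab: "\<And>i. a i \<le> b i"
  defines "S \<equiv> {x::real^'n. \<forall>i. a i \<le> x $ i \<and> x $ i < b i}"
  shows "S \<in> sets borel" "emeasure lborel S = ennreal (\<Prod>i\<in>UNIV. b i - a i)"
proof -
  show S: "S \<in> sets borel" unfolding S_def by measurable
  \<comment> \<open>Finiteness is required to return from \<open>measure\<close>, which is 0 on sets
    of infinite measure, to \<open>emeasure\<close>.\<close>
  have "bounded S"
    by (rule bounded_subset[of "cbox (\<chi> i. a i) (\<chi> i. b i)"]) (auto simp: S_def mem_box_cart less_imp_le)
  hence fin: "emeasure lborel S < \<infinity>" by (rule emeasure_bounded_finite)
  have "measure lborel S = (\<integral>x. indicator S x \<partial>lborel)" by simp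
  also have "\<dots> = (\<integral>x. (\<Prod>i\<in>UNIV. indicator {a i..<b i} (x $ i)) \<partial>(lborel :: (real^'n) measure))"
    by (intro Bochner_Integration.integral_cong) (auto simp: S_def indicator_def)
  also have "\<dots> = (\<Prod>i\<in>UNIV. \<integral>x. indicator {a i..<b i} x \<partial>lborel)"
    by (rule integral_lborel_vec_prod, rule integrable_real_indicator) (use ab in auto)
  also have "\<dots> = (\<Prod>i\<in>UNIV. b i - a i)" using ab by (simp add: measure_def)
  finally show "emeasure lborel S = ennreal (\<Prod>i\<in>UNIV. b i - a i)"
    using fin by (simp add: emeasure_eq_ennreal_measure)
qed

lemma space_torus_measure: "space torus_measure = {x::real^'n. \<forall>i. 0 \<le> x $ i \<and> x $ i < 1}"
  by (simp add: torus_measure_def space_restrict_space)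

lemma prob_space_torus_measure: "prob_space (torus_measure :: (real^'n) measure)"
proof
  have "emeasure (torus_measure :: (real^'n) measure) (space torus_measure)
      = emeasure lborel {x::real^'n. \<forall>i. 0 \<le> x $ i \<and> x $ i < 1}"
    unfolding space_torus_measure unfolding torus_measure_def by (rule emeasure_restrict_space) auto
  also have "\<dots> = 1" using halfopen_box_measure(2)[of "\<lambda>_. 0" "\<lambda>_. 1"] by simp
  finally show "emeasure (torus_measure :: (real^'n) measure) (space torus_measure) = 1" .
qed

text \<open>Every entry of m is at most 2^j - 1, so the cube lies inside the fundamental domain and
  restriction does not change its measure.\<close>

lemma dyadic_cube_measure:
  fixes m :: "nat^'n"
  assumes "m \<in> M_level j"
  shows "dyadic_cube j m \<in> sets torus_measure"
    and "measure torus_measure (dyadic_cube j m) = 1 / 2 ^ (j * CARD('n))"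
proof -
  have le: "real (m $ i) / 2 ^ j \<le> (real (m $ i) + 1) / 2 ^ j" for i by (simp add: divide_right_mono)
  have B: "dyadic_cube j m \<in> sets borel"
    unfolding dyadic_cube_def by (rule halfopen_box_measure(1)[OF le])
  have "dyadic_cube j m \<subseteq> {x. \<forall>i. 0 \<le> x $ i \<and> x $ i < 1}"
  proof (intro subsetI CollectI allI)
    fix x i assume x: "x \<in> dyadic_cube j m"
    have "m $ i < 2 ^ j" using assms by (simp add: M_level_def)
    hence "real (m $ i) + 1 \<le> 2 ^ j"
      by (metis Suc_leI of_nat_Suc of_nat_le_iff of_nat_numeral of_nat_power add.commute)
    hence "(real (m $ i) + 1) / 2 ^ j \<le> 1" by simp
    moreover have "0 \<le> real (m $ i) / 2 ^ j" by simp
    moreover have "real (m $ i) / 2 ^ j \<le> x $ i" "x $ i < (real (m $ i) + 1) / 2 ^ j"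
      using x by (simp_all add: dyadic_cube_def)
    ultimately show "0 \<le> x $ i \<and> x $ i < 1" by linarith
  qed
  note sub = this
  show "dyadic_cube j m \<in> sets torus_measure"
    using B sub by (simp add: torus_measure_def sets_restrict_space_iff)
  have "measure torus_measure (dyadic_cube j m) = measure lborel (dyadic_cube j m)"
    unfolding torus_measure_def by (rule measure_restrict_space) (use sub in auto)
  also have "\<dots> = (\<Prod>i\<in>(UNIV::'n set). 1 / 2 ^ j)"
    unfolding dyadic_cube_def measure_def halfopen_box_measure(2)[OF le]
    by (simp add: diff_divide_distrib[symmetric])
  also have "\<dots> = 1 / 2 ^ (j * CARD('n))" by (simp add: power_one_over power_mult)
  finally show "measure torus_measure (dyadic_cube j m) = 1 / 2 ^ (j * CARD('n))" .
qed

section \<open>Modulars with a bounded variable exponent\<close>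

lemma exp_le_one_plus_mult_exp:
  assumes "0 \<le> y" shows "exp y \<le> 1 + y * exp (y :: real)"
proof -
  have "1 - y \<le> exp (- y)" using exp_ge_add_one_self[of "- y"] by simp
  hence "(1 - y) * exp y \<le> exp (- y) * exp y" by (rule mult_right_mono) simp
  thus ?thesis by (simp add: exp_minus_inverse algebra_simps flip: exp_add)
qed

text \<open>The product (1 - y / 2) (1 + y) equals 1 + y (1 - y) / 2, which is at least 1 on [0, 1],
  and 1 + y is at most exp y.\<close>

lemma exp_neg_le_half:
  assumes "0 \<le> y" "y \<le> 1" shows "exp (- y) \<le> 1 - y / (2 :: real)"
proof -
  have "1 \<le> (1 - y / 2) * (1 + y)"
    using mult_nonneg_nonneg[of y "1 - y"] assms by (simp add: algebra_simps)
  also have "\<dots> \<le> (1 - y / 2) * exp y"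
    using exp_ge_add_one_self[of y] assms by (intro mult_left_mono) auto
  finally have "1 * exp (- y) \<le> ((1 - y / 2) * exp y) * exp (- y)" by (rule mult_right_mono) simp
  thus ?thesis by (simp add: mult.assoc flip: exp_add)
qed

text \<open>One half of the exponential absorbs the power, the other half supplies quadratic
  decay.\<close>

lemma integrable_powr_exp_abs:
  fixes Q c :: real
  assumes "0 < Q" "0 < c"
  shows "integrable lborel (\<lambda>z. (1 + \<bar>z\<bar>) powr Q * exp (- c * \<bar>z\<bar>))"
proof -
  \<comment> \<open>Chosen so that Q a x = c x / 2 once the tangent bound ln v \<le> v - 1 is
    applied to v = a (1 + x).\<close>
  define a where "a = c / (2 * Q)"
  have a: "a > 0" using assms by (simp add: a_def)
  \<comment> \<open>The first factor comes from the tangent bound; the second compares 1 + x^2 with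
    the lower bound 1 + (c x / 2)^2 / 2 for exp (c x / 2).\<close>
  define C where "C = exp (Q * (a - 1 - ln a)) * max 1 (8 / c\<^sup>2)"
  have bound: "(1 + x) powr Q * exp (- c * x) \<le> C / (1 + x\<^sup>2)" if x: "0 \<le> x" for x
  proof -
    have "ln (a * (1 + x)) \<le> a * (1 + x) - 1" using a x by (intro ln_le_minus_one) (simp add: add_pos_nonneg)
    moreover have "ln (a * (1 + x)) = ln a + ln (1 + x)" using a x by (simp add: ln_mult)
    ultimately have "ln (1 + x) \<le> (a - 1 - ln a) + a * x" by (simp add: algebra_simps)
    hence "Q * ln (1 + x) \<le> Q * ((a - 1 - ln a) + a * x)" using assms(1) by (intro mult_left_mono) auto
    also have "\<dots> = Q * (a - 1 - ln a) + c * x / 2" using assms(1) by (simp add: a_def field_simps)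
    finally have "Q * ln (1 + x) + (- c * x) \<le> Q * (a - 1 - ln a) + - (c * x / 2)" by simp
    hence "exp (Q * ln (1 + x) + (- c * x)) \<le> exp (Q * (a - 1 - ln a) + - (c * x / 2))"
      by (simp only: exp_le_cancel_iff)
    hence "(1 + x) powr Q * exp (- c * x) \<le> exp (Q * (a - 1 - ln a)) * exp (- (c * x / 2))"
      using x unfolding exp_add by (simp add: powr_def add_nonneg_eq_0_iff)
    also have "exp (- (c * x / 2)) \<le> max 1 (8 / c\<^sup>2) / (1 + x\<^sup>2)"
    proof -
      have "1 + x\<^sup>2 \<le> max 1 (8 / c\<^sup>2) * (1 + (c * x / 2)\<^sup>2 / 2)"
      proof -
        have "x\<^sup>2 = (8 / c\<^sup>2) * ((c * x / 2)\<^sup>2 / 2)" using assms(2) by (simp add: power2_eq_square field_simps)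
        also have "\<dots> \<le> max 1 (8 / c\<^sup>2) * ((c * x / 2)\<^sup>2 / 2)" by (intro mult_right_mono) auto
        finally have "x\<^sup>2 \<le> max 1 (8 / c\<^sup>2) * ((c * x / 2)\<^sup>2 / 2)" .
        moreover have "1 \<le> max 1 (8 / c\<^sup>2)" by simp
        ultimately have "1 + x\<^sup>2 \<le> max 1 (8 / c\<^sup>2) * 1 + max 1 (8 / c\<^sup>2) * ((c * x / 2)\<^sup>2 / 2)" by linarith
        thus ?thesis by (simp only: distrib_left)
      qed
      also have "\<dots> \<le> max 1 (8 / c\<^sup>2) * exp (c * x / 2)"
      proof (intro mult_left_mono)
        have "0 \<le> c * x / 2" using x assms(2) by simp
        with exp_lower_Taylor_quadratic[OF this] show "1 + (c * x / 2)\<^sup>2 / 2 \<le> exp (c * x / 2)" by linarith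
      qed simp
      finally have "1 + x\<^sup>2 \<le> max 1 (8 / c\<^sup>2) * exp (c * x / 2)" .
      thus ?thesis by (simp add: exp_minus field_simps add_pos_nonneg)
    qed
    finally show ?thesis by (simp add: C_def)
  qed
  have "(\<lambda>z. (1 + \<bar>z\<bar>) powr Q * exp (- c * \<bar>z\<bar>)) \<in> borel_measurable borel" by measurable
  moreover have "\<bar>(1 + \<bar>z\<bar>) powr Q * exp (- c * \<bar>z\<bar>)\<bar> \<le> C / (1 + z\<^sup>2)" for z
    using bound[of "\<bar>z\<bar>"] by (simp add: abs_mult)
  ultimately show ?thesis by (intro integrable_quad_decay) (auto simp: quad_decay_def)
qed

text \<open>The torus enters the estimates only as a probability space. The last two assumptions say
  that Q is the essential supremum of q; \<open>q_sup\<close> is what makes the exponent of the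
  density grow at least like every power of z below Q.\<close>

locale bounded_exponent = prob_space M for M :: "'a measure" +
  fixes q :: "'a \<Rightarrow> real" and Q :: real
  assumes q_measurable [measurable]: "q \<in> borel_measurable M"
    and q_ge_1: "1 \<le> q x"
    and q_le: "AE x in M. q x \<le> Q"
    and q_sup: "c < Q \<Longrightarrow> 0 < prob {x \<in> space M. c < q x}"
begin

lemma Q_ge_1: "1 \<le> Q"
proof -
  have "AE x in M. 1 \<le> Q" using q_le by eventually_elim (use q_ge_1 in \<open>auto intro: order_trans\<close>)
  thus ?thesis by simp
qed

text \<open>The base is enlarged to 1 + |z| because raising the exponent to Q increases the power
  only for a base of at least 1.\<close>

lemma powr_q_le: "q x \<le> Q \<Longrightarrow> \<bar>z\<bar> powr q x \<le> (1 + \<bar>z\<bar>) powr Q"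
proof -
  assume "q x \<le> Q"
  have "\<bar>z\<bar> powr q x \<le> (1 + \<bar>z\<bar>) powr q x" using q_ge_1[of x] by (intro powr_mono2) auto
  also have "\<dots> \<le> (1 + \<bar>z\<bar>) powr Q" using \<open>q x \<le> Q\<close> by (intro powr_mono) auto
  finally show ?thesis .
qed

lemma integrable_AE_bounded:
  assumes "f \<in> borel_measurable M" "AE x in M. \<bar>f x\<bar> \<le> B"
  shows "integrable M (f :: 'a \<Rightarrow> real)"
  using assms by (intro integrable_const_bound[of _ B]) auto

text \<open>The density of the generalised exponential distribution is proportional to exp (- I_q /
  2).\<close>

definition I_q :: "real \<Rightarrow> real" where
  "I_q z = (\<integral>x. \<bar>z\<bar> powr q x \<partial>M)"

text \<open>This is \<open>F_q\<close> over the whole space with e = 0, a majorant uniform in the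
  cube and in e \<le> 0.\<close>

definition Y_q :: "real \<Rightarrow> real \<Rightarrow> real" where
  "Y_q d z = (\<integral>x. d powr (q x / Q) * \<bar>z\<bar> powr q x \<partial>M)"

text \<open>The contribution to the modular of one coefficient with random factor \<open>z\<close>: here \<open>D\<close> is the cube,
  \<open>e = j * (t - s + n / Q)\<close> at its corner, and \<open>d = 1 / \<delta>\<close>.\<close>

definition F_q :: "real \<Rightarrow> 'a set \<Rightarrow> real \<Rightarrow> real \<Rightarrow> real" where
  "F_q d D e z = (\<integral>x. indicator D x * (2 powr (e * q x) * (d powr (q x / Q) * \<bar>z\<bar> powr q x)) \<partial>M)"

lemma I_q_measurable [measurable]: "I_q \<in> borel_measurable borel"
  unfolding I_q_def by measurable

lemma Y_q_measurable [measurable]: "Y_q d \<in> borel_measurable borel"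
  unfolding Y_q_def by measurable

lemma F_q_measurable [measurable (raw)]:
  assumes [measurable]: "D \<in> sets M"
  shows "F_q d D e \<in> borel_measurable borel"
  unfolding F_q_def by measurable

lemma integrable_I_q: "integrable M (\<lambda>x. \<bar>z\<bar> powr q x)"
  by (rule integrable_AE_bounded[of _ "(1 + \<bar>z\<bar>) powr Q"])
     (measurable, use q_le in eventually_elim, use powr_q_le in auto)

text \<open>The exponent q / Q lies in [0, 1], so the power lies between 1 and d; the maximum treats
  d below and above 1 together.\<close>

lemma powr_ratio_le: "q x \<le> Q \<Longrightarrow> 0 < d \<Longrightarrow> d powr (q x / Q) \<le> max 1 d"
proof -
  assume qx: "q x \<le> Q" and d: "0 < d"
  have r: "0 \<le> q x / Q" "q x / Q \<le> 1" using qx q_ge_1[of x] Q_ge_1 by auto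
  show ?thesis
  proof (cases "1 \<le> d")
    case True
    hence "d powr (q x / Q) \<le> d powr 1" using r by (intro powr_mono) auto
    thus ?thesis using True by simp
  next
    case False
    hence "d powr (q x / Q) \<le> 1" using r d by (intro powr_le1) auto
    thus ?thesis by simp
  qed
qed

lemma powr_ratio_ge: "q x \<le> Q \<Longrightarrow> 0 < d \<Longrightarrow> min 1 d \<le> d powr (q x / Q)"
proof -
  assume qx: "q x \<le> Q" and d: "0 < d"
  have r: "0 \<le> q x / Q" "q x / Q \<le> 1" using qx q_ge_1[of x] Q_ge_1 by auto
  show ?thesis
  proof (cases "1 \<le> d")
    case True
    hence "1 \<le> d powr (q x / Q)" using r by (intro ge_one_powr_ge_zero) auto
    thus ?thesis by simp
  next
    case False
    hence "d powr 1 \<le> d powr (q x / Q)" using r d by (intro powr_mono') auto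
    thus ?thesis using d by simp
  qed
qed

lemma integrable_Y_q: "0 < d \<Longrightarrow> integrable M (\<lambda>x. d powr (q x / Q) * \<bar>z\<bar> powr q x)"
  by (rule integrable_AE_bounded[of _ "max 1 d * (1 + \<bar>z\<bar>) powr Q"])
     (measurable, use q_le in eventually_elim,
      auto simp: abs_mult intro!: mult_mono powr_q_le powr_ratio_le)

lemma integrable_F_q:
  assumes "0 < d" and [measurable]: "D \<in> sets M"
  shows "integrable M (\<lambda>x. indicator D x * (2 powr (e * q x) * (d powr (q x / Q) * \<bar>z\<bar> powr q x)))"
proof (rule integrable_AE_bounded[of _ "2 powr (\<bar>e\<bar> * Q) * (max 1 d * (1 + \<bar>z\<bar>) powr Q)"])
  show "AE x in M. \<bar>indicator D x * (2 powr (e * q x) * (d powr (q x / Q) * \<bar>z\<bar> powr q x))\<bar>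
      \<le> 2 powr (\<bar>e\<bar> * Q) * (max 1 d * (1 + \<bar>z\<bar>) powr Q)"
    using q_le
  proof eventually_elim
    case (elim x)
    have "e * q x \<le> \<bar>e\<bar> * q x" using q_ge_1[of x] by (intro mult_right_mono) auto
    also have "\<dots> \<le> \<bar>e\<bar> * Q" using elim by (intro mult_left_mono) auto
    finally have "2 powr (e * q x) \<le> 2 powr (\<bar>e\<bar> * Q)" by simp
    hence "2 powr (e * q x) * (d powr (q x / Q) * \<bar>z\<bar> powr q x)
       \<le> 2 powr (\<bar>e\<bar> * Q) * (max 1 d * (1 + \<bar>z\<bar>) powr Q)"
      using elim assms(1) by (intro mult_mono powr_q_le powr_ratio_le) auto
    thus ?case by (auto simp: indicator_def abs_mult intro!: mult_nonneg_nonneg)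
  qed
qed measurable

lemma F_q_nonneg: "0 \<le> F_q d D e z"
  unfolding F_q_def by (intro integral_nonneg_AE AE_I2) auto

lemma F_q_le_Y_q:
  assumes "0 < d" "D \<in> sets M" "e \<le> 0"
  shows "F_q d D e z \<le> Y_q d z"
  unfolding F_q_def Y_q_def
proof (rule integral_mono[OF integrable_F_q integrable_Y_q])
  fix x
  have "2 powr (e * q x) \<le> 2 powr 0"
    using assms(3) q_ge_1[of x] by (intro powr_mono mult_nonpos_nonneg) auto
  hence "indicator D x * 2 powr (e * q x) \<le> 1 * (1::real)" by (intro mult_mono) (auto simp: indicator_def)
  hence "(indicator D x * 2 powr (e * q x)) * (d powr (q x / Q) * \<bar>z\<bar> powr q x) \<le> 1 * (d powr (q x / Q) * \<bar>z\<bar> powr q x)"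
    by (intro mult_right_mono) auto
  thus "indicator D x * (2 powr (e * q x) * (d powr (q x / Q) * \<bar>z\<bar> powr q x)) \<le> d powr (q x / Q) * \<bar>z\<bar> powr q x"
    by (simp add: mult.assoc)
qed (use assms in auto)

text \<open>Since q is at least 1 and e is not positive, 2 powr (e q) is at most 2 powr e: the decay
  in the level survives the variable exponent.\<close>

lemma F_q_le:
  assumes "0 < d" and D [measurable]: "D \<in> sets M" and "e \<le> 0"
  shows "F_q d D e z \<le> 2 powr e * prob D * (max 1 d * (1 + \<bar>z\<bar>) powr Q)"
proof -
  have "F_q d D e z \<le> (\<integral>x. indicator D x * (2 powr e * (max 1 d * (1 + \<bar>z\<bar>) powr Q)) \<partial>M)"
    unfolding F_q_def
  proof (rule integral_mono_AE[OF integrable_F_q])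
    show "integrable M (\<lambda>x. indicator D x * (2 powr e * (max 1 d * (1 + \<bar>z\<bar>) powr Q)))"
      by (intro integrable_mult_left integrable_real_indicator D) (simp add: emeasure_eq_measure)
    show "AE x in M. indicator D x * (2 powr (e * q x) * (d powr (q x / Q) * \<bar>z\<bar> powr q x))
       \<le> indicator D x * (2 powr e * (max 1 d * (1 + \<bar>z\<bar>) powr Q))"
      using q_le
    proof eventually_elim
      case (elim x)
      have "e * q x \<le> e * 1" using q_ge_1[of x] assms(3) by (intro mult_left_mono_neg) auto
      thus ?case using elim assms(1) by (intro mult_mono powr_q_le powr_ratio_le) auto
    qed
  qed (use assms in auto)
  also have "\<dots> = 2 powr e * prob D * (max 1 d * (1 + \<bar>z\<bar>) powr Q)"
    by (simp add: measure_def)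
  finally show ?thesis .
qed

text \<open>For e \<ge> 0 the dyadic factor is at least 1. Truncating |z| at 1 makes the power with
  exponent Q at most the one with exponent q, whatever the size of z.\<close>

lemma F_q_ge:
  assumes "0 < d" and D [measurable]: "D \<in> sets M" and "0 \<le> e"
  shows "prob D * (min 1 d * min 1 \<bar>z\<bar> powr Q) \<le> F_q d D e z"
proof -
  have "prob D * (min 1 d * min 1 \<bar>z\<bar> powr Q) = (\<integral>x. indicator D x * (1 * (min 1 d * min 1 \<bar>z\<bar> powr Q)) \<partial>M)"
    by (simp add: measure_def)
  also have "\<dots> \<le> F_q d D e z"
    unfolding F_q_def
  proof (rule integral_mono_AE[OF _ integrable_F_q])
    show "integrable M (\<lambda>x. indicator D x * (1 * (min 1 d * min 1 \<bar>z\<bar> powr Q)))"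
      by (intro integrable_mult_left integrable_real_indicator D) (simp add: emeasure_eq_measure)
    show "AE x in M. indicator D x * (1 * (min 1 d * min 1 \<bar>z\<bar> powr Q))
       \<le> indicator D x * (2 powr (e * q x) * (d powr (q x / Q) * \<bar>z\<bar> powr q x))"
      using q_le
    proof eventually_elim
      case (elim x)
      have "1 \<le> 2 powr (e * q x)" using q_ge_1[of x] assms(3) by (intro ge_one_powr_ge_zero) auto
      moreover have "min 1 \<bar>z\<bar> powr Q \<le> \<bar>z\<bar> powr q x"
      proof -
        have "min 1 \<bar>z\<bar> powr Q \<le> min 1 \<bar>z\<bar> powr q x" using elim by (intro powr_mono') auto
        also have "\<dots> \<le> \<bar>z\<bar> powr q x" using q_ge_1[of x] by (intro powr_mono2) auto
        finally show ?thesis .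
      qed
      ultimately show ?case using elim assms(1) by (intro mult_mono powr_ratio_ge) auto
    qed
  qed (use assms in auto)
  finally show ?thesis .
qed

text \<open>Linear growth comes from q \<ge> 1; it turns any positive multiple of I_q left in the
  exponent into an exponential tail.\<close>

lemma I_q_ge: "\<bar>z\<bar> - 1 \<le> I_q z"
proof -
  have "(\<integral>x. \<bar>z\<bar> - 1 \<partial>M) \<le> I_q z"
    unfolding I_q_def
  proof (rule integral_mono[OF _ integrable_I_q])
    fix x
    show "\<bar>z\<bar> - 1 \<le> \<bar>z\<bar> powr q x"
    proof (cases "1 \<le> \<bar>z\<bar>")
      case True
      hence "\<bar>z\<bar> powr 1 \<le> \<bar>z\<bar> powr q x" using q_ge_1 by (intro powr_mono) auto
      thus ?thesis using True by simp
    next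
      case False
      thus ?thesis using powr_ge_zero[of "\<bar>z\<bar>" "q x"] by linarith
    qed
  qed auto
  thus ?thesis by (simp add: prob_space)
qed

text \<open>Split at \<open>q = \<theta> * Q\<close> with \<open>\<theta> < 1\<close> so near to 1 that \<open>\<alpha> * d powr \<theta> < 1 / 2\<close>. Above the
  threshold \<open>d powr (q / Q)\<close> is controlled directly. Below it the integrand grows at most like
  \<open>\<bar>z\<bar> powr (\<theta> * Q)\<close>, which \<open>I_q\<close> dominates because \<open>q > \<theta>' * Q\<close> has positive probability for some
  \<open>\<theta>' > \<theta>\<close>.\<close>

lemma Y_q_le_I_q:
  assumes d: "0 < d" and \<alpha>: "0 \<le> \<alpha>" "\<alpha> * d < 1 / 2"
  obtains K b where "b < 1 / 2" "\<And>z. \<alpha> * Y_q d z \<le> K + b * I_q z"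
proof -
  have "((\<lambda>\<theta>. \<alpha> * d powr \<theta>) \<longlongrightarrow> \<alpha> * d powr 1) (at_left 1)"
    using d by (intro tendsto_intros) auto
  hence "eventually (\<lambda>\<theta>. \<alpha> * d powr \<theta> < 1 / 2) (at_left 1)"
    using \<alpha>(2) d by (intro order_tendstoD(2)) auto
  moreover have "eventually (\<lambda>\<theta>::real. \<theta> \<in> {0<..<1}) (at_left 1)"
    by (rule eventually_at_left_real) simp
  ultimately have "eventually (\<lambda>\<theta>. \<alpha> * d powr \<theta> < 1 / 2 \<and> \<theta> \<in> {0<..<1}) (at_left 1)"
    by (rule eventually_conj)
  then obtain \<theta> where \<theta>: "\<alpha> * d powr \<theta> < 1 / 2" "0 < \<theta>" "\<theta> < 1"
    using eventually_happens[of _ "at_left (1::real)"] by force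
  \<comment> \<open>For q / Q in [\<theta>, 1] the power of d is largest at one of the two ends,
    depending on whether d is below or above 1.\<close>
  define b0 where "b0 = max (\<alpha> * d powr \<theta>) (\<alpha> * d)"
  have b0: "b0 < 1 / 2" "0 \<le> b0" using \<theta> \<alpha> d by (auto simp: b0_def le_max_iff_disj)
  define A where "A = \<alpha> * max 1 d"
  have A: "0 \<le> A" using \<alpha> by (simp add: A_def)
  \<comment> \<open>An intermediate exponent: \<theta>' Q is below Q, so \<open>q_sup\<close>
    applies, and above \<theta> Q, so it wins for large |z|.\<close>
  define \<theta>' where "\<theta>' = (1 + \<theta>) / 2"
  have \<theta>': "\<theta> < \<theta>'" "\<theta>' < 1" using \<theta> by (auto simp: \<theta>'_def)
  define S where "S = {x \<in> space M. \<theta>' * Q < q x}"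
  have S [measurable]: "S \<in> sets M" unfolding S_def by measurable
  have p: "0 < prob S" unfolding S_def using \<theta>' Q_ge_1 by (intro q_sup) simp
  \<comment> \<open>Half of the room between b0 and 1/2, which keeps b0 + \<epsilon> below
    1/2.\<close>
  define \<epsilon> where "\<epsilon> = (1 / 2 - b0) / 2"
  have \<epsilon>: "0 < \<epsilon>" using b0 by (simp add: \<epsilon>_def)
  \<comment> \<open>Solves \<epsilon> prob S R powr ((\<theta>' - \<theta>) Q) = A, so that beyond R
    the exponent \<theta>' Q takes over.\<close>
  define R where "R = (A / (\<epsilon> * prob S)) powr (1 / ((\<theta>' - \<theta>) * Q))"
  \<comment> \<open>One A is for the constant in 1 + |z| powr (\<theta> Q); the bracket bounds the
    power itself for |z| < 1 and for |z| between 1 and R.\<close>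
  define K where "K = A + (A + A * R powr (\<theta> * Q))"
  have I0: "0 \<le> I_q z" for z unfolding I_q_def by (intro integral_nonneg_AE) auto
  have Ilow: "prob S * \<bar>z\<bar> powr (\<theta>' * Q) \<le> I_q z" if z: "1 \<le> \<bar>z\<bar>" for z
  proof -
    have "prob S * \<bar>z\<bar> powr (\<theta>' * Q) = (\<integral>x. indicator S x * \<bar>z\<bar> powr (\<theta>' * Q) \<partial>M)"
      by (simp add: measure_def)
    also have "\<dots> \<le> I_q z" unfolding I_q_def
    proof (rule integral_mono[OF _ integrable_I_q])
      show "integrable M (\<lambda>x. indicator S x * \<bar>z\<bar> powr (\<theta>' * Q))"
        by (intro integrable_mult_left integrable_real_indicator S) (simp add: emeasure_eq_measure)
      fix x
      show "indicator S x * \<bar>z\<bar> powr (\<theta>' * Q) \<le> \<bar>z\<bar> powr q x"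
        using z by (auto simp: indicator_def S_def intro!: powr_mono)
    qed
    finally show ?thesis .
  qed
  have tail: "A * \<bar>z\<bar> powr (\<theta> * Q) \<le> (A + A * R powr (\<theta> * Q)) + \<epsilon> * I_q z" for z
  proof (cases "1 \<le> \<bar>z\<bar>")
    case False
    hence "\<bar>z\<bar> powr (\<theta> * Q) \<le> 1" using \<theta> Q_ge_1 by (intro powr_le1) auto
    hence "A * \<bar>z\<bar> powr (\<theta> * Q) \<le> A * 1" using A by (rule mult_left_mono)
    moreover have "0 \<le> A * R powr (\<theta> * Q)" "0 \<le> \<epsilon> * I_q z" using A \<epsilon> I0 by auto
    ultimately show ?thesis by linarith
  next
    case True
    have exps: "0 < (\<theta>' - \<theta>) * Q" "0 \<le> \<theta> * Q" using \<theta>' \<theta> Q_ge_1 by auto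
    show ?thesis
    proof (cases "\<bar>z\<bar> \<le> R")
      case le: True
      hence "A * \<bar>z\<bar> powr (\<theta> * Q) \<le> A * R powr (\<theta> * Q)"
        using A exps by (intro mult_left_mono powr_mono2) auto
      moreover have "0 \<le> \<epsilon> * I_q z" using \<epsilon> I0 by auto
      ultimately show ?thesis using A by linarith
    next
      case gt: False
      have "R powr ((\<theta>' - \<theta>) * Q) \<le> \<bar>z\<bar> powr ((\<theta>' - \<theta>) * Q)"
        using gt exps by (intro powr_mono2) (auto simp: R_def)
      moreover have "R powr ((\<theta>' - \<theta>) * Q) = A / (\<epsilon> * prob S)"
      proof -
        have "1 / c * c = 1" if "0 < c" for c :: real using that by simp
        note this[OF exps(1)]
        thus ?thesis unfolding R_def powr_powr using A \<epsilon> p by simp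
      qed
      ultimately have "A / (\<epsilon> * prob S) \<le> \<bar>z\<bar> powr ((\<theta>' - \<theta>) * Q)" by simp
      hence "A \<le> \<epsilon> * prob S * \<bar>z\<bar> powr ((\<theta>' - \<theta>) * Q)"
        using \<epsilon> p by (subst (asm) pos_divide_le_eq) (simp_all add: mult.commute)
      hence "A * \<bar>z\<bar> powr (\<theta> * Q) \<le> (\<epsilon> * prob S * \<bar>z\<bar> powr ((\<theta>' - \<theta>) * Q)) * \<bar>z\<bar> powr (\<theta> * Q)"
        by (rule mult_right_mono) simp
      also have "\<dots> = \<epsilon> * (prob S * \<bar>z\<bar> powr (\<theta>' * Q))"
        by (simp add: mult.assoc algebra_simps flip: powr_add)
      also have "\<dots> \<le> \<epsilon> * I_q z" using Ilow[OF True] \<epsilon> by (intro mult_left_mono) auto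
      finally show ?thesis using A mult_nonneg_nonneg[OF A powr_ge_zero[of R "\<theta> * Q"]] by linarith
    qed
  qed
  have "\<alpha> * Y_q d z \<le> K + (b0 + \<epsilon>) * I_q z" for z
  proof -
    have "\<alpha> * Y_q d z = (\<integral>x. \<alpha> * (d powr (q x / Q) * \<bar>z\<bar> powr q x) \<partial>M)" by (simp add: Y_q_def)
    also have "\<dots> \<le> (\<integral>x. b0 * \<bar>z\<bar> powr q x + A * (1 + \<bar>z\<bar> powr (\<theta> * Q)) \<partial>M)"
    proof (rule integral_mono_AE)
      show "integrable M (\<lambda>x. \<alpha> * (d powr (q x / Q) * \<bar>z\<bar> powr q x))"
        by (intro integrable_mult_right integrable_Y_q d)
      show "integrable M (\<lambda>x. b0 * \<bar>z\<bar> powr q x + A * (1 + \<bar>z\<bar> powr (\<theta> * Q)))"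
        by (intro Bochner_Integration.integrable_add integrable_mult_right integrable_I_q) auto
      show "AE x in M. \<alpha> * (d powr (q x / Q) * \<bar>z\<bar> powr q x) \<le> b0 * \<bar>z\<bar> powr q x + A * (1 + \<bar>z\<bar> powr (\<theta> * Q))"
        using q_le
      proof eventually_elim
        case (elim x)
        show ?case
        proof (cases "\<theta> * Q \<le> q x")
          case True
          have r: "\<theta> \<le> q x / Q" "q x / Q \<le> 1" using True elim Q_ge_1 by (auto simp: field_simps)
          have "d powr (q x / Q) \<le> max (d powr \<theta>) (d powr 1)"
          proof (cases "1 \<le> d")
            case True
            thus ?thesis using r by (intro max.coboundedI2 powr_mono) auto
          next
            case False
            thus ?thesis using r d by (intro max.coboundedI1 powr_mono') auto
          qed
          hence "\<alpha> * d powr (q x / Q) \<le> \<alpha> * max (d powr \<theta>) (d powr 1)" using \<alpha> by (intro mult_left_mono)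
          also have "\<dots> = b0" using \<alpha> d by (simp add: b0_def max_mult_distrib_left)
          finally have "(\<alpha> * d powr (q x / Q)) * \<bar>z\<bar> powr q x \<le> b0 * \<bar>z\<bar> powr q x" by (rule mult_right_mono) simp
          moreover have "0 \<le> A * (1 + \<bar>z\<bar> powr (\<theta> * Q))" using A by simp
          ultimately show ?thesis by (simp add: mult.assoc)
        next
          case False
          have "\<bar>z\<bar> powr q x \<le> 1 + \<bar>z\<bar> powr (\<theta> * Q)"
          proof (cases "1 \<le> \<bar>z\<bar>")
            case True
            hence "\<bar>z\<bar> powr q x \<le> \<bar>z\<bar> powr (\<theta> * Q)" using False by (intro powr_mono) auto
            thus ?thesis by simp
          next
            case False
            hence "\<bar>z\<bar> powr q x \<le> 1" using q_ge_1[of x] by (intro powr_le1) auto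
            thus ?thesis using powr_ge_zero[of "\<bar>z\<bar>" "\<theta> * Q"] by linarith
          qed
          hence "d powr (q x / Q) * \<bar>z\<bar> powr q x \<le> max 1 d * (1 + \<bar>z\<bar> powr (\<theta> * Q))"
            using elim d by (intro mult_mono powr_ratio_le) auto
          hence "\<alpha> * (d powr (q x / Q) * \<bar>z\<bar> powr q x) \<le> \<alpha> * (max 1 d * (1 + \<bar>z\<bar> powr (\<theta> * Q)))"
            using \<alpha> by (intro mult_left_mono)
          moreover have "0 \<le> b0 * \<bar>z\<bar> powr q x" using b0 by simp
          ultimately show ?thesis by (simp add: A_def mult.assoc)
        qed
      qed
    qed
    also have "\<dots> = b0 * I_q z + A * (1 + \<bar>z\<bar> powr (\<theta> * Q))"
      using integrable_I_q[of z] by (subst Bochner_Integration.integral_add) (auto simp: I_q_def prob_space)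
    also have "\<dots> \<le> b0 * I_q z + (A + ((A + A * R powr (\<theta> * Q)) + \<epsilon> * I_q z))"
      using tail[of z] by (simp add: algebra_simps)
    finally show ?thesis by (simp add: K_def algebra_simps)
  qed
  moreover have "b0 + \<epsilon> < 1 / 2" using b0 by (simp add: \<epsilon>_def field_simps)
  ultimately show ?thesis using that by blast
qed

end

section \<open>Sums of independent nonnegative terms\<close>

lemma ennreal_exp_measurable [measurable]: "ennreal_exp \<in> borel_measurable borel"
  unfolding ennreal_exp_def by measurable

text \<open>Monotone continuity of the extended exponential, which prepares monotone convergence. In
  the divergent case a finite supremum would bound the partial sums, since exp y \<ge> 1 +
  y.\<close>

lemma ennreal_exp_suminf:
  fixes f :: "nat \<Rightarrow> real"
  assumes f: "\<And>j. 0 \<le> f j"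
  shows "ennreal_exp (\<Sum>j. ennreal (f j)) = (SUP N. ennreal (exp (\<Sum>j<N. f j)))"
proof (cases "summable f")
  case True
  have eq: "(\<Sum>j. ennreal (f j)) = ennreal (suminf f)" by (rule suminf_ennreal2[OF f True])
  have "(\<lambda>N. exp (\<Sum>j<N. f j)) \<longlonglongrightarrow> exp (suminf f)"
    by (intro tendsto_exp summable_LIMSEQ True)
  hence lim: "(\<lambda>N. ennreal (exp (\<Sum>j<N. f j))) \<longlonglongrightarrow> ennreal (exp (suminf f))" by (intro tendsto_ennrealI)
  have "incseq (\<lambda>N. ennreal (exp (\<Sum>j<N. f j)))"
    using f by (intro incseq_SucI ennreal_leI) simp
  from LIMSEQ_unique[OF LIMSEQ_SUP[OF this] lim] show ?thesis
    unfolding eq using suminf_nonneg[OF True f] by (simp add: ennreal_exp_def)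
next
  case False
  have top: "(\<Sum>j. ennreal (f j)) = \<infinity>"
  proof (rule ccontr)
    assume "(\<Sum>j. ennreal (f j)) \<noteq> \<infinity>"
    hence "summable f" using f by (intro summable_suminf_not_top) auto
    thus False using False by simp
  qed
  have sup: "(SUP N. ennreal (exp (\<Sum>j<N. f j))) = \<infinity>"
  proof (rule ccontr)
    assume "(SUP N. ennreal (exp (\<Sum>j<N. f j))) \<noteq> \<infinity>"
    then obtain B where B: "(SUP N. ennreal (exp (\<Sum>j<N. f j))) = ennreal B" "0 \<le> B"
      by (metis ennreal_cases infinity_ennreal_def)
    have "(\<Sum>j<N. f j) \<le> B" for N
    proof -
      have "ennreal (exp (\<Sum>j<N. f j)) \<le> ennreal B" unfolding B(1)[symmetric] by (rule SUP_upper) simp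
      hence "exp (\<Sum>j<N. f j) \<le> B" using B(2) by simp
      with exp_ge_add_one_self[of "\<Sum>j<N. f j"] show ?thesis by linarith
    qed
    hence "summable f" using f by (intro summableI_nonneg_bounded)
    thus False using False by simp
  qed
  show ?thesis unfolding top sup by (simp add: ennreal_exp_def)
qed

text \<open>The disjoint levels below N merge into one finite index set, on which independence turns
  the expectation of the product into the product of expectations.\<close>

lemma (in prob_space) nn_integral_prod_levels:
  fixes X :: "'i \<Rightarrow> 'a \<Rightarrow> real" and J :: "nat \<Rightarrow> 'i set"
  assumes indep: "indep_vars (\<lambda>_. borel) X I"
    and J: "\<And>j. finite (J j)" "\<And>j. J j \<subseteq> I" "disjoint_family J"
    and [measurable]: "h \<in> borel_measurable borel"
  shows "(\<integral>\<^sup>+\<omega>. (\<Prod>j<N::nat. \<Prod>i\<in>J j. h (X i \<omega>)) \<partial>M)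
    = (\<Prod>j<N. \<Prod>i\<in>J j. \<integral>\<^sup>+\<omega>. h (X i \<omega>) \<partial>M :: ennreal)"
proof -
  define U where "U = (\<Union>j<N. J j)"
  have un: "(\<Prod>j<N. \<Prod>i\<in>J j. g i) = prod g U" for g :: "'i \<Rightarrow> ennreal"
    unfolding U_def using J by (intro prod.UNION_disjoint[symmetric]) (auto simp: disjoint_family_on_def)
  have "indep_vars (\<lambda>_. borel) X U"
    using J by (intro indep_vars_subset[OF indep]) (auto simp: U_def)
  hence "indep_vars (\<lambda>_. borel) (\<lambda>i \<omega>. h (X i \<omega>)) U"
    by (rule indep_vars_compose2[where Y = "\<lambda>_. h"]) simp
  hence "(\<integral>\<^sup>+\<omega>. (\<Prod>i\<in>U. h (X i \<omega>)) \<partial>M) = (\<Prod>i\<in>U. \<integral>\<^sup>+\<omega>. h (X i \<omega>) \<partial>M)"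
    using J(1) by (intro indep_vars_nn_integral) (auto simp: U_def)
  thus ?thesis by (simp only: un)
qed

lemma prod_mono_ennreal:
  fixes f g :: "'i \<Rightarrow> ennreal"
  assumes "\<And>i. i \<in> A \<Longrightarrow> f i \<le> g i"
  shows "prod f A \<le> prod g A"
  using assms by (induction A rule: infinite_finite_induct) (auto intro!: mult_mono)

text \<open>Monotone convergence reduces to finitely many levels; there independence and 1 + a \<le>
  exp a bound the moment by exp S, uniformly in N.\<close>

lemma (in prob_space) indep_sum_exp_moment_finite:
  fixes X :: "'i \<Rightarrow> 'a \<Rightarrow> real" and J :: "nat \<Rightarrow> 'i set"
  assumes indep: "indep_vars (\<lambda>_. borel) X I"
    and J: "\<And>j. finite (J j)" "\<And>j. J j \<subseteq> I" "disjoint_family J"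
    and nonneg: "\<And>i \<omega>. 0 \<le> X i \<omega>"
    and bound: "\<And>i. i \<in> I \<Longrightarrow> (\<integral>\<^sup>+\<omega>. ennreal (exp (X i \<omega>)) \<partial>M) \<le> ennreal (1 + a i)"
    and a: "\<And>i. 0 \<le> a i" "\<And>N::nat. (\<Sum>j<N. \<Sum>i\<in>J j. a i) \<le> S"
  shows "(\<integral>\<^sup>+\<omega>. ennreal_exp (\<Sum>j. \<Sum>i\<in>J j. ennreal (X i \<omega>)) \<partial>M) < \<infinity>"
proof -
  have meas: "X i \<in> borel_measurable M" if "i \<in> I" for i
    using indep that by (auto simp: indep_vars_def)
  have [measurable]: "(\<lambda>\<omega>. \<Sum>j<N. \<Sum>i\<in>J j. X i \<omega>) \<in> borel_measurable M" for N
    using meas J(2) by (intro borel_measurable_sum) auto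
  have "(\<integral>\<^sup>+\<omega>. ennreal_exp (\<Sum>j. \<Sum>i\<in>J j. ennreal (X i \<omega>)) \<partial>M)
     = (\<integral>\<^sup>+\<omega>. (SUP N. ennreal (exp (\<Sum>j<N. \<Sum>i\<in>J j. X i \<omega>))) \<partial>M)"
    using nonneg by (simp add: sum_ennreal sum_nonneg ennreal_exp_suminf)
  also have "\<dots> = (SUP N. \<integral>\<^sup>+\<omega>. ennreal (exp (\<Sum>j<N. \<Sum>i\<in>J j. X i \<omega>)) \<partial>M)"
  proof (rule nn_integral_monotone_convergence_SUP)
    show "incseq (\<lambda>N \<omega>. ennreal (exp (\<Sum>j<N. \<Sum>i\<in>J j. X i \<omega>)))"
      using nonneg by (intro incseq_SucI le_funI ennreal_leI) (simp add: sum_nonneg)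
  qed measurable
  also have "\<dots> \<le> ennreal (exp S)"
  proof (rule SUP_least)
    fix N
    have "(\<integral>\<^sup>+\<omega>. ennreal (exp (\<Sum>j<N. \<Sum>i\<in>J j. X i \<omega>)) \<partial>M)
       = (\<integral>\<^sup>+\<omega>. (\<Prod>j<N. \<Prod>i\<in>J j. ennreal (exp (X i \<omega>))) \<partial>M)"
      using J(1) by (simp add: exp_sum prod_ennreal prod_nonneg)
    also have "\<dots> = (\<Prod>j<N. \<Prod>i\<in>J j. \<integral>\<^sup>+\<omega>. ennreal (exp (X i \<omega>)) \<partial>M)"
      by (rule nn_integral_prod_levels[OF indep J, of "\<lambda>x. ennreal (exp x)"]) measurable
    also have "\<dots> \<le> (\<Prod>j<N. \<Prod>i\<in>J j. ennreal (exp (a i)))"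
    proof (intro prod_mono_ennreal)
      fix j i assume "i \<in> J j"
      hence "i \<in> I" using J(2) by blast
      note bound[OF this]
      also have "ennreal (1 + a i) \<le> ennreal (exp (a i))" by (intro ennreal_leI) simp
      finally show "(\<integral>\<^sup>+\<omega>. ennreal (exp (X i \<omega>)) \<partial>M) \<le> ennreal (exp (a i))" .
    qed
    also have "\<dots> = ennreal (exp (\<Sum>j<N. \<Sum>i\<in>J j. a i))"
      using J(1) by (simp add: exp_sum prod_ennreal prod_nonneg)
    also have "\<dots> \<le> ennreal (exp S)" using a(2) by (intro ennreal_leI) simp
    finally show "(\<integral>\<^sup>+\<omega>. ennreal (exp (\<Sum>j<N. \<Sum>i\<in>J j. X i \<omega>)) \<partial>M) \<le> ennreal (exp S)" .
  qed
  also have "\<dots> < \<infinity>" by simp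
  finally show ?thesis .
qed

text \<open>The expectation of exp of minus the sum is at most exp (- N S) for every N, hence 0. A
  nonnegative variable with zero mean vanishes almost surely, which here means that the sum is
  infinite.\<close>

lemma (in prob_space) indep_sum_diverges:
  fixes X :: "'i \<Rightarrow> 'a \<Rightarrow> real" and J :: "nat \<Rightarrow> 'i set"
  assumes indep: "indep_vars (\<lambda>_. borel) X I"
    and J: "\<And>j. finite (J j)" "\<And>j. J j \<subseteq> I" "disjoint_family J"
    and nonneg: "\<And>i \<omega>. 0 \<le> X i \<omega>"
    and bound: "\<And>i. i \<in> I \<Longrightarrow> (\<integral>\<^sup>+\<omega>. ennreal (exp (- X i \<omega>)) \<partial>M) \<le> ennreal (1 - a i)"
    and a: "0 < S" "\<And>j. S \<le> (\<Sum>i\<in>J j. a i)"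
  shows "AE \<omega> in M. (\<Sum>j. \<Sum>i\<in>J j. ennreal (X i \<omega>)) = \<infinity>"
proof -
  have meas: "X i \<in> borel_measurable M" if "i \<in> I" for i
    using indep that by (auto simp: indep_vars_def)
  define \<rho> where "\<rho> \<omega> = (\<Sum>j. \<Sum>i\<in>J j. ennreal (X i \<omega>))" for \<omega>
  have "(\<lambda>\<omega>. \<Sum>i\<in>J j. ennreal (X i \<omega>)) \<in> borel_measurable M" for j
    using J(2) by (intro borel_measurable_sum measurable_compose[OF meas measurable_ennreal]) auto
  hence [measurable]: "\<rho> \<in> borel_measurable M" unfolding \<rho>_def by measurable
  \<comment> \<open>The value 0 at infinity has to be set by hand: \<open>enn2real\<close> sends
    infinity to 0, which would give exp 0 = 1.\<close>
  define f where "f \<omega> = (if \<rho> \<omega> = \<infinity> then 0 else ennreal (exp (- enn2real (\<rho> \<omega>))))" for \<omega>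
  have [measurable]: "f \<in> borel_measurable M" unfolding f_def by measurable
  have le: "(\<integral>\<^sup>+\<omega>. f \<omega> \<partial>M) \<le> ennreal (exp (- (real N * S)))" for N
  proof -
    have "(\<integral>\<^sup>+\<omega>. f \<omega> \<partial>M) \<le> (\<integral>\<^sup>+\<omega>. (\<Prod>j<N. \<Prod>i\<in>J j. ennreal (exp (- X i \<omega>))) \<partial>M)"
    proof (rule nn_integral_mono)
      fix \<omega>
      show "f \<omega> \<le> (\<Prod>j<N. \<Prod>i\<in>J j. ennreal (exp (- X i \<omega>)))"
      proof (cases "\<rho> \<omega> = \<infinity>")
        case False
        have "ennreal (\<Sum>j<N. \<Sum>i\<in>J j. X i \<omega>) = (\<Sum>j<N. \<Sum>i\<in>J j. ennreal (X i \<omega>))"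
          using nonneg by (simp add: sum_ennreal sum_nonneg)
        also have "\<dots> \<le> \<rho> \<omega>" unfolding \<rho>_def by (intro sum_le_suminf) auto
        finally have "ennreal (\<Sum>j<N. \<Sum>i\<in>J j. X i \<omega>) \<le> \<rho> \<omega>" .
        from enn2real_mono[OF this] False have "(\<Sum>j<N. \<Sum>i\<in>J j. X i \<omega>) \<le> enn2real (\<rho> \<omega>)"
          using nonneg by (simp add: sum_nonneg less_top)
        hence "f \<omega> \<le> ennreal (exp (\<Sum>j<N. \<Sum>i\<in>J j. - X i \<omega>))"
          using False by (simp add: f_def sum_negf ennreal_leI)
        also have "\<dots> = (\<Prod>j<N. \<Prod>i\<in>J j. ennreal (exp (- X i \<omega>)))"
          using J(1) by (simp add: exp_sum prod_ennreal prod_nonneg)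
        finally show ?thesis .
      qed (simp add: f_def)
    qed
    also have "\<dots> = (\<Prod>j<N. \<Prod>i\<in>J j. \<integral>\<^sup>+\<omega>. ennreal (exp (- X i \<omega>)) \<partial>M)"
      by (rule nn_integral_prod_levels[OF indep J, of "\<lambda>x. ennreal (exp (- x))"]) measurable
    also have "\<dots> \<le> (\<Prod>j<N. \<Prod>i\<in>J j. ennreal (exp (- a i)))"
    proof (intro prod_mono_ennreal)
      fix j i assume "i \<in> J j"
      hence "i \<in> I" using J(2) by blast
      note bound[OF this]
      also have "ennreal (1 - a i) \<le> ennreal (exp (- a i))"
        using exp_ge_add_one_self[of "- a i"] by (intro ennreal_leI) simp
      finally show "(\<integral>\<^sup>+\<omega>. ennreal (exp (- X i \<omega>)) \<partial>M) \<le> ennreal (exp (- a i))" .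
    qed
    also have "\<dots> = ennreal (exp (\<Sum>j<N. \<Sum>i\<in>J j. - a i))"
      using J(1) by (simp add: exp_sum prod_ennreal prod_nonneg)
    also have "\<dots> \<le> ennreal (exp (- (real N * S)))"
      using sum_mono[of "{..<N}" "\<lambda>_. S" "\<lambda>j. \<Sum>i\<in>J j. a i"] a(2)
      by (intro ennreal_leI) (simp add: sum_negf)
    finally show ?thesis .
  qed
  have "(\<lambda>N. exp (- (real N * S))) \<longlonglongrightarrow> 0"
    using a(1) by (intro filterlim_compose[OF exp_at_bot] filterlim_uminus_at_bot_at_top[THEN filterlim_compose]
        filterlim_at_top_mult_tendsto_pos[where c = S] tendsto_const filterlim_real_sequentially)
  hence "(\<lambda>N. ennreal (exp (- (real N * S)))) \<longlonglongrightarrow> ennreal 0" by (intro tendsto_ennrealI)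
  hence "(\<integral>\<^sup>+\<omega>. f \<omega> \<partial>M) \<le> ennreal 0" using le by (intro LIMSEQ_le_const) auto
  hence "(\<integral>\<^sup>+\<omega>. f \<omega> \<partial>M) = 0" by simp
  hence "AE \<omega> in M. f \<omega> = 0" by (simp add: nn_integral_0_iff_AE)
  thus ?thesis
    by eventually_elim (auto simp: f_def \<rho>_def[symmetric] split: if_splits)
qed

section \<open>Moments under the generalised exponential distribution\<close>

context bounded_exponent
begin

text \<open>Because \<alpha> Y_q is at most K + b I_q with b < 1/2, a factor exp (- (1/2 - b) I_q)
  of the density is left over, and linear growth of I_q makes it an exponential tail that beats the
  power.\<close>

lemma gen_exp_moment_finite:
  assumes d: "0 < d" and \<alpha>: "0 \<le> \<alpha>" "\<alpha> * d < 1 / 2" and Z: "0 \<le> Z"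
  shows "(\<integral>\<^sup>+z. ennreal ((1 + \<bar>z\<bar>) powr Q * exp (\<alpha> * Y_q d z))
     \<partial>density lborel (\<lambda>z. ennreal (exp (- (1 / 2) * I_q z) / Z))) < \<infinity>"
proof -
  obtain K b where b: "b < 1 / 2" and K: "\<And>z. \<alpha> * Y_q d z \<le> K + b * I_q z"
    using Y_q_le_I_q[OF d \<alpha>] by blast
  define \<eta> where "\<eta> = 1 / 2 - b"
  have \<eta>: "0 < \<eta>" using b by (simp add: \<eta>_def)
  define C where "C = exp (K + \<eta>) / Z"
  have bound: "(exp (- (1 / 2) * I_q z) / Z) * ((1 + \<bar>z\<bar>) powr Q * exp (\<alpha> * Y_q d z))
      \<le> C * ((1 + \<bar>z\<bar>) powr Q * exp (- \<eta> * \<bar>z\<bar>))" for z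
  proof -
    have "\<eta> * (\<bar>z\<bar> - 1) \<le> \<eta> * I_q z" using I_q_ge \<eta> by (intro mult_left_mono) auto
    moreover have "\<eta> * (\<bar>z\<bar> - 1) = \<eta> * \<bar>z\<bar> - \<eta>" by (simp add: algebra_simps)
    moreover have "- (1 / 2) * I_q z + (K + b * I_q z) = K - \<eta> * I_q z" by (simp add: \<eta>_def algebra_simps)
    ultimately have "- (1 / 2) * I_q z + \<alpha> * Y_q d z \<le> (K + \<eta>) + - \<eta> * \<bar>z\<bar>"
      using K[of z] by linarith
    hence "exp (- (1 / 2) * I_q z + \<alpha> * Y_q d z) \<le> exp ((K + \<eta>) + - \<eta> * \<bar>z\<bar>)"
      by (simp only: exp_le_cancel_iff)
    hence "exp (- (1 / 2) * I_q z) * exp (\<alpha> * Y_q d z) \<le> exp (K + \<eta>) * exp (- \<eta> * \<bar>z\<bar>)"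
      by (simp only: exp_add)
    hence "((1 + \<bar>z\<bar>) powr Q / Z) * (exp (- (1 / 2) * I_q z) * exp (\<alpha> * Y_q d z))
        \<le> ((1 + \<bar>z\<bar>) powr Q / Z) * (exp (K + \<eta>) * exp (- \<eta> * \<bar>z\<bar>))"
      using Z by (intro mult_left_mono) auto
    thus ?thesis by (simp add: C_def mult_ac)
  qed
  have int: "integrable lborel (\<lambda>z. C * ((1 + \<bar>z\<bar>) powr Q * exp (- \<eta> * \<bar>z\<bar>)))"
    using Q_ge_1 \<eta> by (intro integrable_mult_right integrable_powr_exp_abs) auto
  have C: "0 \<le> C" using Z by (simp add: C_def)
  have "(\<integral>\<^sup>+z. ennreal ((1 + \<bar>z\<bar>) powr Q * exp (\<alpha> * Y_q d z))
     \<partial>density lborel (\<lambda>z. ennreal (exp (- (1 / 2) * I_q z) / Z)))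
     = (\<integral>\<^sup>+z. ennreal (exp (- (1 / 2) * I_q z) / Z) * ennreal ((1 + \<bar>z\<bar>) powr Q * exp (\<alpha> * Y_q d z)) \<partial>lborel)"
    by (rule nn_integral_density) measurable
  also have "\<dots> \<le> (\<integral>\<^sup>+z. ennreal (C * ((1 + \<bar>z\<bar>) powr Q * exp (- \<eta> * \<bar>z\<bar>))) \<partial>lborel)"
    using bound Z by (intro nn_integral_mono) (simp add: ennreal_mult'[symmetric] ennreal_leI)
  also have "\<dots> = ennreal (\<integral>z. C * ((1 + \<bar>z\<bar>) powr Q * exp (- \<eta> * \<bar>z\<bar>)) \<partial>lborel)"
    using C by (intro nn_integral_eq_integral int) auto
  also have "\<dots> < \<infinity>" by simp
  finally show ?thesis .
qed

text \<open>In exp y \<le> 1 + y exp y with y = \<alpha> F_q, the factor y carries the smallness 2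
  powr e prob D, while the exponential is bounded by that of \<alpha> Y_q. The remaining integral
  does not depend on D or e.\<close>

lemma exp_F_q_moment:
  assumes d: "0 < d" and \<alpha>: "0 \<le> \<alpha>" "\<alpha> * d < 1 / 2" and Z: "0 \<le> Z"
    and \<mu>: "\<mu> = density lborel (\<lambda>z. ennreal (exp (- (1 / 2) * I_q z) / Z))" "prob_space \<mu>"
  obtains K where "0 \<le> K" "\<And>D e. D \<in> sets M \<Longrightarrow> e \<le> 0 \<Longrightarrow>
     (\<integral>\<^sup>+z. ennreal (exp (\<alpha> * F_q d D e z)) \<partial>\<mu>) \<le> ennreal (1 + K * (2 powr e * prob D))"
proof -
  interpret \<mu>: prob_space \<mu> by fact
  have [measurable_cong]: "sets \<mu> = sets borel" by (simp add: \<mu>)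
  define K0 where "K0 = enn2real (\<integral>\<^sup>+z. ennreal ((1 + \<bar>z\<bar>) powr Q * exp (\<alpha> * Y_q d z)) \<partial>\<mu>)"
  have K0: "(\<integral>\<^sup>+z. ennreal ((1 + \<bar>z\<bar>) powr Q * exp (\<alpha> * Y_q d z)) \<partial>\<mu>) = ennreal K0"
    using gen_exp_moment_finite[OF d \<alpha> Z] by (simp add: K0_def \<mu>(1))
  have K0_nonneg: "0 \<le> K0" by (simp add: K0_def)
  define K where "K = \<alpha> * max 1 d * K0"
  show ?thesis
  proof (rule that[of K])
    show "0 \<le> K" using \<alpha> K0_nonneg by (simp add: K_def)
    fix D and e :: real assume D [measurable]: "D \<in> sets M" and e: "e \<le> 0"
    define c where "c = \<alpha> * max 1 d * (2 powr e * prob D)"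
    have c: "0 \<le> c" using \<alpha> by (simp add: c_def)
    have "(\<integral>\<^sup>+z. ennreal (exp (\<alpha> * F_q d D e z)) \<partial>\<mu>)
        \<le> (\<integral>\<^sup>+z. 1 + ennreal c * ennreal ((1 + \<bar>z\<bar>) powr Q * exp (\<alpha> * Y_q d z)) \<partial>\<mu>)"
    proof (rule nn_integral_mono)
      fix z
      have "exp (\<alpha> * F_q d D e z) \<le> 1 + \<alpha> * F_q d D e z * exp (\<alpha> * F_q d D e z)"
        using \<alpha> F_q_nonneg by (intro exp_le_one_plus_mult_exp) auto
      also have "\<alpha> * F_q d D e z * exp (\<alpha> * F_q d D e z)
          \<le> (\<alpha> * (2 powr e * prob D * (max 1 d * (1 + \<bar>z\<bar>) powr Q))) * exp (\<alpha> * Y_q d z)"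
        using \<alpha> F_q_le[OF d D e] F_q_le_Y_q[OF d D e] F_q_nonneg
        by (intro mult_mono mult_left_mono) (auto intro!: mult_left_mono mult_nonneg_nonneg)
      finally have "exp (\<alpha> * F_q d D e z) \<le> 1 + c * ((1 + \<bar>z\<bar>) powr Q * exp (\<alpha> * Y_q d z))"
        by (simp add: c_def mult_ac)
      hence "ennreal (exp (\<alpha> * F_q d D e z)) \<le> ennreal (1 + c * ((1 + \<bar>z\<bar>) powr Q * exp (\<alpha> * Y_q d z)))"
        by (rule ennreal_leI)
      also have "\<dots> = 1 + ennreal c * ennreal ((1 + \<bar>z\<bar>) powr Q * exp (\<alpha> * Y_q d z))"
        using c by (simp add: ennreal_plus ennreal_mult')
      finally show "ennreal (exp (\<alpha> * F_q d D e z)) \<le> 1 + ennreal c * ennreal ((1 + \<bar>z\<bar>) powr Q * exp (\<alpha> * Y_q d z))" .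
    qed
    also have "\<dots> = 1 + ennreal c * ennreal K0"
      by (simp add: nn_integral_add nn_integral_cmult K0 \<mu>.emeasure_space_1)
    also have "\<dots> = ennreal (1 + K * (2 powr e * prob D))"
      using c K0_nonneg by (simp add: ennreal_plus ennreal_mult'[symmetric] K_def c_def mult_ac \<alpha>)
    finally show "(\<integral>\<^sup>+z. ennreal (exp (\<alpha> * F_q d D e z)) \<partial>\<mu>) \<le> ennreal (1 + K * (2 powr e * prob D))" .
  qed
qed

text \<open>A measure with a density gives no mass to 0, the only zero of the truncated power w, so
  w has positive mean. The lower bound on F_q then gains a fixed multiple of prob D.\<close>

lemma exp_neg_F_q_moment:
  assumes d: "0 < d"
    and \<mu>: "\<mu> = density lborel g" "g \<in> borel_measurable borel" "prob_space \<mu>"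
  obtains W where "0 < W" "\<And>D e. D \<in> sets M \<Longrightarrow> 0 \<le> e \<Longrightarrow>
     (\<integral>\<^sup>+z. ennreal (exp (- F_q d D e z)) \<partial>\<mu>) \<le> ennreal (1 - W * prob D)"
proof -
  interpret \<mu>: prob_space \<mu> by fact
  have [measurable_cong]: "sets \<mu> = sets borel" by (simp add: \<mu>)
  define w where "w z = min 1 \<bar>z\<bar> powr Q" for z :: real
  have [measurable]: "w \<in> borel_measurable borel" unfolding w_def by measurable
  have w: "0 \<le> w z" "w z \<le> 1" for z
    using Q_ge_1 by (auto simp: w_def intro: powr_le1)
  have iw: "integrable \<mu> w" using w by (intro \<mu>.integrable_const_bound[of _ 1]) auto
  have "AE z in \<mu>. z \<noteq> 0"
    unfolding \<mu>(1) using \<mu>(2) AE_lborel_singleton[of "0::real"] by (subst AE_density) auto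
  hence "AE z in \<mu>. w z \<noteq> 0" by eventually_elim (simp add: w_def)
  have "(\<integral>z. w z \<partial>\<mu>) \<noteq> 0"
  proof
    assume "(\<integral>z. w z \<partial>\<mu>) = 0"
    hence "AE z in \<mu>. w z = 0" using w by (subst (asm) integral_nonneg_eq_0_iff_AE[OF iw]) auto
    with \<open>AE z in \<mu>. w z \<noteq> 0\<close> have "AE z in \<mu>. False" by eventually_elim simp
    thus False by simp
  qed
  moreover have "0 \<le> (\<integral>z. w z \<partial>\<mu>)" using w by (intro integral_nonneg_AE) auto
  ultimately have w_pos: "0 < (\<integral>z. w z \<partial>\<mu>)" by simp
  define W where "W = min 1 d / 2 * (\<integral>z. w z \<partial>\<mu>)"
  show ?thesis
  proof (rule that[of W])
    show "0 < W" using d w_pos by (simp add: W_def)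
    fix D and e :: real assume D [measurable]: "D \<in> sets M" and e: "0 \<le> e"
    \<comment> \<open>Half the coefficient of w in the lower bound: 2 c w lies in [0, 1], as
      \<open>exp_neg_le_half\<close> demands, and its bound loses the factor 2.\<close>
    define c where "c = prob D * min 1 d / 2"
    have "prob D * min 1 d \<le> 1 * 1" using d by (intro mult_mono) auto
    hence c: "0 \<le> c" "2 * c \<le> 1" using d by (simp_all add: c_def)
    have cw: "0 \<le> 2 * c * w z" "2 * c * w z \<le> 1" for z
    proof -
      show "0 \<le> 2 * c * w z" using c w[of z] by simp
      have "2 * c * w z \<le> 1 * 1" using c w[of z] by (intro mult_mono) auto
      thus "2 * c * w z \<le> 1" by simp
    qed
    have "(\<integral>\<^sup>+z. ennreal (exp (- F_q d D e z)) \<partial>\<mu>) \<le> (\<integral>\<^sup>+z. ennreal (1 - c * w z) \<partial>\<mu>)"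
    proof (intro nn_integral_mono ennreal_leI)
      fix z
      have "2 * c * w z = prob D * (min 1 d * min 1 \<bar>z\<bar> powr Q)" by (simp add: c_def w_def)
      hence "exp (- F_q d D e z) \<le> exp (- (2 * c * w z))"
        using F_q_ge[OF d D e, of z] by simp
      also have "\<dots> \<le> 1 - 2 * c * w z / 2" by (intro exp_neg_le_half cw)
      finally show "exp (- F_q d D e z) \<le> 1 - c * w z" by simp
    qed
    also have "\<dots> = ennreal (\<integral>z. 1 - c * w z \<partial>\<mu>)"
    proof (rule nn_integral_eq_integral)
      have "0 \<le> 1 - c * w z" for z using cw[of z] by linarith
      thus "AE z in \<mu>. 0 \<le> 1 - c * w z" by simp
      show "integrable \<mu> (\<lambda>z. 1 - c * w z)"
        by (intro Bochner_Integration.integrable_diff integrable_mult_right iw) simp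
    qed
    also have "(\<integral>z. 1 - c * w z \<partial>\<mu>) = 1 - W * prob D"
    proof -
      have "(\<integral>z. 1 - c * w z \<partial>\<mu>) = (\<integral>z. 1 \<partial>\<mu>) - (\<integral>z. c * w z \<partial>\<mu>)"
        by (intro Bochner_Integration.integral_diff integrable_mult_right iw) simp
      thus ?thesis by (simp add: \<mu>.prob_space W_def c_def)
    qed
    finally show "(\<integral>\<^sup>+z. ennreal (exp (- F_q d D e z)) \<partial>\<mu>) \<le> ennreal (1 - W * prob D)" .
  qed
qed

end

section \<open>The modular of a wavelet series as a sum over levels\<close>

lemma var_exponent_log_bounded_exponent:
  fixes q :: "real^'n \<Rightarrow> real"
  assumes "var_exponent_log q"
  shows "bounded_exponent torus_measure q (q_plus q)"
proof -
  interpret T: prob_space "torus_measure :: (real^'n) measure" by (rule prob_space_torus_measure)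
  have [measurable]: "q \<in> borel_measurable torus_measure" and q1: "\<And>x. 1 \<le> q x"
    using assms by (auto simp: var_exponent_log_def var_exponent_def)
  \<comment> \<open>Finiteness lets \<open>q_plus\<close> represent the essential supremum
    faithfully; \<open>real_of_ereal\<close> sends infinite values to 0.\<close>
  have "1 \<le> ess_sup q" "ess_sup q < \<infinity>"
    using assms by (auto simp: var_exponent_log_def intro: order_trans)
  hence Q: "esssup torus_measure (\<lambda>x. ereal (q x)) = ereal (q_plus q)"
    unfolding q_plus_def ess_sup_def[symmetric] by (cases "ess_sup q") auto
  show ?thesis
  proof
    show "AE x in torus_measure. q x \<le> q_plus q"
      using esssup_AE[of "\<lambda>x. ereal (q x)" torus_measure] unfolding Q by simp
    fix c assume "c < q_plus q"
    hence "0 < emeasure torus_measure {x \<in> space torus_measure. ereal c < ereal (q x)}"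
      by (intro esssup_pos_measure) (auto simp: Q)
    thus "0 < T.prob {x \<in> space torus_measure. c < q x}"
      by (simp add: T.emeasure_eq_measure)
  qed (use q1 in auto)
qed

text \<open>The component j is kept so that the levels are disjoint subsets of
  \<open>wavelet_index\<close>, as the lemmas on independent sums require.\<close>

definition level_index :: "nat \<Rightarrow> (nat \<times> (gender^'n) \<times> (nat^'n)) set" where
  "level_index j = {j} \<times> G_level j \<times> M_level j"

lemma finite_level_index: "finite (level_index j)"
  by (simp add: level_index_def)

lemma level_index_subset: "level_index j \<subseteq> wavelet_index"
  by (auto simp: level_index_def wavelet_index_def)

lemma disjoint_level_index: "disjoint_family level_index"
  by (auto simp: disjoint_family_on_def level_index_def)

lemma sum_level_index: "(\<Sum>i\<in>level_index j. f i) = (\<Sum>G\<in>G_level j. \<Sum>m\<in>M_level j. f (j, G, m))"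
  by (simp add: level_index_def sum.cartesian_product')

text \<open>The factor 2^(j n / 2) of the coefficient cancels the n / 2 in
  \<open>besov_scale\<close>, so the powers of 2 combine to the exponent j q (t - s + n / Q).
  Tonelli moves the integral inside the sums. The coefficients are one fixed sample.\<close>

lemma besov_modular_wavelet_series:
  fixes q s t :: "real^'n \<Rightarrow> real"
  defines "Q \<equiv> q_plus q"
  assumes q: "bounded_exponent torus_measure q Q" and \<delta>: "0 < \<delta>"
    and \<psi>: "orthonormal_wavelet_system \<psi>" "\<And>g. quad_decay (\<psi> g)"
  shows "besov_modular \<psi> t q (wavelet_series \<psi> (\<lambda>j G m. besov_scale \<delta> s q j m * \<xi> (j, G, m)))
    = (\<Sum>j. \<Sum>(j, G, m)\<in>level_index j. ennreal (bounded_exponent.F_q torus_measure q Q (1 / \<delta>) (dyadic_cube j m)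
        (real j * (t (dyadic_point j m) - s (dyadic_point j m) + real CARD('n) / Q)) (\<xi> (j, G, m))))"
proof -
  interpret bounded_exponent torus_measure q Q by (rule q)
  define u where "u = wavelet_series \<psi> (\<lambda>j G m. besov_scale \<delta> s q j m * \<xi> (j, G, m))"
  define f where "f j G m x = 2 powr (real j * q x * t (dyadic_point j m))
          * \<bar>wavelet_coeff \<psi> u j G m\<bar> powr q x * indicator (dyadic_cube j m) x" for j G m x
  have cube [measurable]: "m \<in> M_level j \<Longrightarrow> dyadic_cube j m \<in> sets torus_measure" for j m
    by (rule dyadic_cube_measure)
  have f_meas: "(\<lambda>x. ennreal (f j G m x)) \<in> borel_measurable torus_measure" if "m \<in> M_level j" for j G m
    using that unfolding f_def by measurable
  have f_eq: "(\<integral>\<^sup>+x. ennreal (f j G m x) \<partial>torus_measure) = ennreal (F_q (1 / \<delta>) (dyadic_cube j m)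
        (real j * (t (dyadic_point j m) - s (dyadic_point j m) + real CARD('n) / Q)) (\<xi> (j, G, m)))"
    if GM: "G \<in> G_level j" "m \<in> M_level j" for j G m
  proof -
    define e where "e = real j * (t (dyadic_point j m) - s (dyadic_point j m) + real CARD('n) / Q)"
    define z where "z = \<xi> (j, G, m)"
    have "wavelet_coeff \<psi> u j G m = 2 powr (real j * real CARD('n) / 2) * (besov_scale \<delta> s q j m * z)"
      unfolding u_def z_def using GM by (intro wavelet_coeff_wavelet_series \<psi>) (simp add: wavelet_index_def)
    also have "\<dots> = 2 powr (real j * real CARD('n) / 2 + - (real j * (s (dyadic_point j m) + real CARD('n) / 2 - real CARD('n) / Q)))
        * ((1 / \<delta>) powr (1 / Q) * z)"
      unfolding powr_add by (simp add: besov_scale_def Q_def)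
    also have "real j * real CARD('n) / 2 + - (real j * (s (dyadic_point j m) + real CARD('n) / 2 - real CARD('n) / Q))
        = e - real j * t (dyadic_point j m)"
      by (simp add: e_def algebra_simps)
    finally have w: "\<bar>wavelet_coeff \<psi> u j G m\<bar> = 2 powr (e - real j * t (dyadic_point j m)) * ((1 / \<delta>) powr (1 / Q) * \<bar>z\<bar>)"
      by (simp add: abs_mult)
    have "f j G m x = indicator (dyadic_cube j m) x * (2 powr (e * q x) * ((1 / \<delta>) powr (q x / Q) * \<bar>z\<bar> powr q x))" for x
    proof -
      have "2 powr (real j * q x * t (dyadic_point j m)) * \<bar>wavelet_coeff \<psi> u j G m\<bar> powr q x
        = (2 powr (real j * q x * t (dyadic_point j m)) * 2 powr ((e - real j * t (dyadic_point j m)) * q x))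
          * ((1 / \<delta>) powr (1 / Q * q x) * \<bar>z\<bar> powr q x)"
        unfolding w using \<delta> by (simp add: powr_mult powr_powr)
      also have "2 powr (real j * q x * t (dyadic_point j m)) * 2 powr ((e - real j * t (dyadic_point j m)) * q x)
        = 2 powr (e * q x)"
        unfolding powr_add[symmetric] by (simp add: algebra_simps)
      finally show ?thesis by (simp add: f_def mult_ac)
    qed
    hence "(\<integral>\<^sup>+x. ennreal (f j G m x) \<partial>torus_measure)
      = (\<integral>\<^sup>+x. ennreal (indicator (dyadic_cube j m) x * (2 powr (e * q x) * ((1 / \<delta>) powr (q x / Q) * \<bar>z\<bar> powr q x))) \<partial>torus_measure)"
      by simp
    also have "\<dots> = ennreal (F_q (1 / \<delta>) (dyadic_cube j m) e z)"
      unfolding F_q_def using \<delta> cube[OF GM(2)] by (intro nn_integral_eq_integral integrable_F_q) auto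
    finally show ?thesis by (simp add: e_def z_def)
  qed
  have "besov_modular \<psi> t q u = (\<integral>\<^sup>+x. (\<Sum>j. \<Sum>G\<in>G_level j. \<Sum>m\<in>M_level j. ennreal (f j G m x)) \<partial>torus_measure)"
    by (simp add: besov_modular_def f_def)
  also have "\<dots> = (\<Sum>j. \<integral>\<^sup>+x. (\<Sum>G\<in>G_level j. \<Sum>m\<in>M_level j. ennreal (f j G m x)) \<partial>torus_measure)"
    using f_meas by (intro nn_integral_suminf borel_measurable_sum) auto
  also have "\<dots> = (\<Sum>j. \<Sum>G\<in>G_level j. \<integral>\<^sup>+x. (\<Sum>m\<in>M_level j. ennreal (f j G m x)) \<partial>torus_measure)"
    using f_meas by (subst nn_integral_sum) (auto intro!: borel_measurable_sum)
  also have "\<dots> = (\<Sum>j. \<Sum>G\<in>G_level j. \<Sum>m\<in>M_level j. \<integral>\<^sup>+x. ennreal (f j G m x) \<partial>torus_measure)"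
    using f_meas by (subst nn_integral_sum) auto
  also have "\<dots> = (\<Sum>j. \<Sum>(j, G, m)\<in>level_index j. ennreal (F_q (1 / \<delta>) (dyadic_cube j m)
        (real j * (t (dyadic_point j m) - s (dyadic_point j m) + real CARD('n) / Q)) (\<xi> (j, G, m))))"
    using f_eq by (simp add: sum_level_index)
  finally show ?thesis unfolding u_def .
qed

text \<open>The vector with all entries \<open>M_type\<close> lies in every level.\<close>

lemma card_G_level_bounds:
  "1 \<le> card (G_level j :: (gender^'n) set)" "card (G_level j :: (gender^'n) set) \<le> CARD(gender^'n)"
proof -
  have "(\<chi> i. M_type) \<in> (G_level j :: (gender^'n) set)" by (simp add: G_level_def)
  hence "G_level j \<noteq> ({} :: (gender^'n) set)" by blast
  thus "1 \<le> card (G_level j :: (gender^'n) set)" by (simp add: Suc_le_eq card_gt_0_iff)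
  show "card (G_level j :: (gender^'n) set) \<le> CARD(gender^'n)" by (intro card_mono) auto
qed

text \<open>The 2^(j n) cubes of a level have total measure 1, which leaves only the number of types
  G, bounded above and below independently of j.\<close>

lemma sum_level_index_measure:
  "(\<Sum>(j, G, m)\<in>(level_index j :: (nat \<times> (gender^'n) \<times> (nat^'n)) set). measure torus_measure (dyadic_cube j m))
    = real (card (G_level j :: (gender^'n) set))"
  by (simp add: sum_level_index dyadic_cube_measure(2) card_M_level)

text \<open>A finite expectation excludes the value infinity almost surely. Positivity of \<alpha>
  matters, since 0 times infinity is 0 in \<open>ennreal\<close>.\<close>

lemma AE_finite_if_exp_moment:
  assumes [measurable]: "\<rho> \<in> borel_measurable M" and "0 < \<alpha>"
    and fin: "(\<integral>\<^sup>+\<omega>. ennreal_exp (ennreal \<alpha> * \<rho> \<omega>) \<partial>M) < \<infinity>"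
  shows "AE \<omega> in M. \<rho> \<omega> < \<infinity>"
proof -
  have "AE \<omega> in M. ennreal_exp (ennreal \<alpha> * \<rho> \<omega>) \<noteq> \<infinity>"
    using fin by (intro nn_integral_PInf_AE) auto
  thus ?thesis
  proof eventually_elim
    case (elim \<omega>)
    show ?case
    proof (rule ccontr)
      assume "\<not> \<rho> \<omega> < \<infinity>"
      hence "\<rho> \<omega> = \<top>" by (simp add: not_less top_unique)
      with elim assms(2) show False by (simp add: ennreal_exp_def ennreal_mult_top)
    qed
  qed
qed

section \<open>Finiteness, exponential moments and the sign of t - s + n / Q\<close>

theorem theorem3p4:
  fixes t s q :: "real^'n \<Rightarrow> real"
    and \<delta> :: real
    and \<psi> :: "gender \<Rightarrow> real \<Rightarrow> real"
    and P :: "'w measure"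
    and \<xi> :: "nat \<times> (gender^'n) \<times> (nat^'n) \<Rightarrow> 'w \<Rightarrow> real"
    and u :: "'w \<Rightarrow> 'n gen_fun"
  assumes "CARD('n) \<le> 3"
    and "admissible_system {s, t} \<psi>"
    and "C_log_loc t" and "torus_Linf t"
    and "C_log_loc s" and "torus_Linf s"
    and "0 < ess_inf s" and "\<forall>x. ess_inf s \<le> ereal (s x)"
    and "var_exponent_log q"
    and "0 < \<delta>"
    and "\<forall>x. t x - s x + real CARD('n) / q_plus q \<noteq> 0"
    and "prob_space P"
    and "prob_space.indep_vars P (\<lambda>_. borel) \<xi> wavelet_index"
    and "\<forall>i\<in>wavelet_index. distr P borel (\<xi> i) = gen_exp_distribution q torus_measure"
    and "\<forall>\<omega>. u \<omega> = wavelet_series \<psi> (\<lambda>j G m. besov_scale \<delta> s q j m * \<xi> (j, G, m) \<omega>)"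
  shows "((AE \<omega> in P. besov_modular \<psi> t q (u \<omega>) < \<infinity>) \<longleftrightarrow>
            (\<forall>\<alpha>\<in>{0..<\<delta> / 2}. (\<integral>\<^sup>+\<omega>. ennreal_exp (ennreal \<alpha> * besov_modular \<psi> t q (u \<omega>)) \<partial>P) < \<infinity>))
       \<and> ((\<forall>\<alpha>\<in>{0..<\<delta> / 2}. (\<integral>\<^sup>+\<omega>. ennreal_exp (ennreal \<alpha> * besov_modular \<psi> t q (u \<omega>)) \<partial>P) < \<infinity>) \<longleftrightarrow>
            (SUP x. t x - s x + real CARD('n) / q_plus q) < 0)"
proof -

  \<comment> \<open>Reduction of the modular to a sum of nonnegative terms\<close>
  define Q where "Q = q_plus q"
  define r where "r x = t x - s x + real CARD('n) / Q" for x
  define F where "F i = (case i of (j, G, m) \<Rightarrow>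
      bounded_exponent.F_q torus_measure q Q (1 / \<delta>) (dyadic_cube j m) (real j * r (dyadic_point j m)))"
    for i :: "nat \<times> (gender^'n) \<times> (nat^'n)"
  define D where "D i = (case i of (j, G, m) \<Rightarrow> dyadic_cube j m)" for i :: "nat \<times> (gender^'n) \<times> (nat^'n)"
  define X where "X i \<omega> = F i (\<xi> i \<omega>)" for i \<omega>
  define \<rho> where "\<rho> \<omega> = (\<Sum>j. \<Sum>i\<in>level_index j. ennreal (X i \<omega>))" for \<omega>
  interpret T: bounded_exponent torus_measure q Q
    unfolding Q_def by (rule var_exponent_log_bounded_exponent[OF assms(9)])
  interpret P: prob_space P by (rule assms(12))
  have \<delta>: "0 < \<delta>" "0 < 1 / \<delta>" using assms(10) by simp_all
  have \<psi>: "orthonormal_wavelet_system \<psi>" "\<And>g. quad_decay (\<psi> g)"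
    using admissible_system_quad_decay[OF assms(2)] by auto
  have modular: "besov_modular \<psi> t q (u \<omega>) = \<rho> \<omega>" for \<omega>
  proof -
    have "besov_modular \<psi> t q (u \<omega>)
      = besov_modular \<psi> t q (wavelet_series \<psi> (\<lambda>j G m. besov_scale \<delta> s q j m * (\<lambda>i. \<xi> i \<omega>) (j, G, m)))"
      by (subst assms(15)[rule_format]) simp
    also have "\<dots> = \<rho> \<omega>"
      using besov_modular_wavelet_series[OF T.bounded_exponent_axioms[unfolded Q_def] \<delta>(1) \<psi>, of t s "\<lambda>i. \<xi> i \<omega>"]
      by (simp add: \<rho>_def X_def F_def r_def Q_def case_prod_unfold)
    finally show ?thesis .
  qed

  \<comment> \<open>Law, measurability and independence of the terms\<close>
  define Z where "Z = (\<integral>z. gen_exp_weight q torus_measure z \<partial>lborel)"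
  define \<mu> where "\<mu> = gen_exp_distribution q torus_measure"
  have Z: "0 \<le> Z" unfolding Z_def gen_exp_weight_def by (intro integral_nonneg_AE AE_I2) simp
  have \<mu>: "\<mu> = density lborel (\<lambda>z. ennreal (exp (- (1 / 2) * T.I_q z) / Z))"
    by (simp add: \<mu>_def gen_exp_distribution_def Z_def gen_exp_weight_def T.I_q_def)
  have \<xi>_meas: "\<xi> i \<in> borel_measurable P" if "i \<in> wavelet_index" for i
    using assms(13) that by (auto simp: P.indep_vars_def)
  have \<xi>_distr: "distr P borel (\<xi> i) = \<mu>" if "i \<in> wavelet_index" for i
    using assms(14) that by (simp add: \<mu>_def)
  \<comment> \<open>An index is exhibited because normalisation of \<open>\<mu>\<close> is inferred
    from its being the law of some \<open>\<xi> i\<close>.\<close>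
  have "level_index 0 \<noteq> ({} :: (nat \<times> (gender^'n) \<times> (nat^'n)) set)"
    using card_G_level_bounds(1)[of 0, where 'n = 'n] by (auto simp: level_index_def M_level_def intro: exI[of _ 0])
  then obtain i0 :: "nat \<times> (gender^'n) \<times> (nat^'n)" where "i0 \<in> wavelet_index"
    using level_index_subset by blast
  hence \<mu>_prob: "prob_space \<mu>" using P.prob_space_distr[OF \<xi>_meas] \<xi>_distr by metis

  have D [measurable]: "D i \<in> sets torus_measure" if "i \<in> wavelet_index" for i
    using that dyadic_cube_measure(1) by (auto simp: D_def wavelet_index_def)
  have F_eq: "F i = T.F_q (1 / \<delta>) (D i) (real (fst i) * r (dyadic_point (fst i) (snd (snd i))))" for i
    by (simp add: F_def D_def case_prod_unfold)
  have F_meas: "F i \<in> borel_measurable borel" if "i \<in> wavelet_index" for i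
    unfolding F_eq by (intro T.F_q_measurable D that)
  have X_nonneg: "0 \<le> X i \<omega>" for i \<omega>
    unfolding X_def F_eq by (rule T.F_q_nonneg)
  have X_meas: "X i \<in> borel_measurable P" if "i \<in> wavelet_index" for i
    unfolding X_def using measurable_compose[OF \<xi>_meas F_meas] that by simp
  \<comment> \<open>The factor c will be \<alpha> for the exponential moments and 1 for the
    divergence.\<close>
  have indep: "P.indep_vars (\<lambda>_. borel) (\<lambda>i \<omega>. c * X i \<omega>) wavelet_index" for c :: real
    unfolding X_def using F_meas
    by (intro P.indep_vars_compose2[OF assms(13), where Y = "\<lambda>i z. c * F i z"]) auto
  have transfer: "(\<integral>\<^sup>+\<omega>. h (X i \<omega>) \<partial>P) = (\<integral>\<^sup>+z. h (F i z) \<partial>\<mu>)"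
    if "i \<in> wavelet_index" "h \<in> borel_measurable borel" for i and h :: "real \<Rightarrow> ennreal"
  proof -
    have "(\<integral>\<^sup>+z. h (F i z) \<partial>distr P borel (\<xi> i)) = (\<integral>\<^sup>+\<omega>. h (F i (\<xi> i \<omega>)) \<partial>P)"
      by (rule nn_integral_distr)
         (use \<xi>_meas that measurable_compose[OF F_meas[OF that(1)] that(2)] in simp_all)
    thus ?thesis by (simp add: X_def \<xi>_distr[OF that(1)])
  qed
  have "(\<lambda>\<omega>. \<Sum>i\<in>level_index j. ennreal (X i \<omega>)) \<in> borel_measurable P" for j
    using level_index_subset by (intro borel_measurable_sum measurable_compose[OF X_meas measurable_ennreal]) auto
  hence \<rho>_meas: "\<rho> \<in> borel_measurable P" unfolding \<rho>_def by measurable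

  let ?one = "AE \<omega> in P. \<rho> \<omega> < \<infinity>"
  let ?two = "\<forall>\<alpha>\<in>{0..<\<delta> / 2}. (\<integral>\<^sup>+\<omega>. ennreal_exp (ennreal \<alpha> * \<rho> \<omega>) \<partial>P) < \<infinity>"
  let ?three = "(SUP x. r x) < 0"
  \<comment> \<open>Any positive number below \<delta> / 2 could replace \<delta> / 4.\<close>
  have two_one: ?one if ?two
    using that \<delta> by (intro AE_finite_if_exp_moment[OF \<rho>_meas, of "\<delta> / 4"]) auto

  have "torus_fun r"
    using assms(3,5) by (auto simp: C_log_loc_def torus_fun_def r_def)
  moreover have "continuous_on UNIV r"
    unfolding r_def by (intro continuous_intros C_log_loc_continuous assms)
  moreover have "r x \<noteq> 0" for x using assms(11) by (simp add: r_def Q_def)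
  ultimately consider c where "0 < c" "\<And>x. r x \<le> - c" ?three | "\<And>x. 0 < r x" "\<not> ?three"
    using torus_sign_dichotomy[of r] by blast
  hence "(?one \<longleftrightarrow> ?two) \<and> (?two \<longleftrightarrow> ?three)"
  proof cases

    \<comment> \<open>Negative r: finite exponential moments\<close>
    case 1
    have ?two
    proof
      fix \<alpha> assume "\<alpha> \<in> {0..<\<delta> / 2}"
      \<comment> \<open>The threshold \<delta> / 2 becomes the condition \<alpha> d < 1/2 with d = 1
        / \<delta>.\<close>
      hence \<alpha>: "0 \<le> \<alpha>" "\<alpha> * (1 / \<delta>) < 1 / 2" using \<delta> by (auto simp: field_simps)
      obtain K where K: "0 \<le> K" "\<And>D e. D \<in> sets torus_measure \<Longrightarrow> e \<le> 0 \<Longrightarrow>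
         (\<integral>\<^sup>+z. ennreal (exp (\<alpha> * T.F_q (1 / \<delta>) D e z)) \<partial>\<mu>) \<le> ennreal (1 + K * (2 powr e * measure torus_measure D))"
        using T.exp_F_q_moment[OF \<delta>(2) \<alpha> Z \<mu> \<mu>_prob] by blast
      define a where "a i = K * (2 powr (real (fst i) * r (dyadic_point (fst i) (snd (snd i)))) * measure torus_measure (D i))"
        for i
      define B where "B = K * real CARD(gender^'n)"
      \<comment> \<open>Every exponent at level j is at most - c j, and the cubes of the level
        contribute a bounded total measure, so the level sums decay geometrically.\<close>
      have level: "(\<Sum>i\<in>level_index j. a i) \<le> B * (2 powr (- c)) ^ j" for j
      proof -
        have "(\<Sum>i\<in>level_index j. a i) \<le> (\<Sum>i\<in>level_index j. K * (2 powr (- c)) ^ j * measure torus_measure (D i))"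
        proof (rule sum_mono)
          fix i :: "nat \<times> (gender^'n) \<times> (nat^'n)" assume "i \<in> level_index j"
          hence fst: "fst i = j" by (auto simp: level_index_def)
          have "real j * r (dyadic_point j (snd (snd i))) \<le> real j * - c" using 1(2) by (intro mult_left_mono) auto
          hence "2 powr (real j * r (dyadic_point j (snd (snd i)))) \<le> 2 powr (- c * real j)"
            by (intro powr_mono) (simp_all add: mult.commute)
          also have "\<dots> = (2 powr (- c)) ^ j" by (simp only: powr_powr[symmetric] powr_realpow powr_gt_zero)
          finally have "K * 2 powr (real j * r (dyadic_point j (snd (snd i)))) * measure torus_measure (D i)
            \<le> K * (2 powr (- c)) ^ j * measure torus_measure (D i)"
            using K(1) by (intro mult_right_mono mult_left_mono) auto
          thus "a i \<le> K * (2 powr (- c)) ^ j * measure torus_measure (D i)" by (simp add: a_def fst mult.assoc)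
        qed
        also have "\<dots> = K * (2 powr (- c)) ^ j * (\<Sum>i\<in>level_index j. measure torus_measure (D i))"
          by (simp only: sum_distrib_left)
        also have "(\<Sum>i\<in>level_index j. measure torus_measure (D i)) = real (card (G_level j :: (gender^'n) set))"
          using sum_level_index_measure[of j, where 'n = 'n] by (simp add: D_def case_prod_unfold)
        also have "K * (2 powr (- c)) ^ j * real (card (G_level j :: (gender^'n) set)) \<le> K * (2 powr (- c)) ^ j * real CARD(gender^'n)"
          using K(1) card_G_level_bounds(2)[of j, where 'n = 'n] by (intro mult_left_mono) auto
        finally show ?thesis by (simp add: B_def mult_ac)
      qed
      have B: "0 \<le> B" using K(1) by (simp add: B_def)
      have small: "norm (2 powr (- c)) < 1" using 1(1) by (simp add: powr_less_one)
      have "(\<Sum>j<N. \<Sum>i\<in>level_index j. a i) \<le> B * (1 / (1 - 2 powr (- c)))" for N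
      proof -
        have "(\<Sum>j<N. \<Sum>i\<in>level_index j. a i) \<le> (\<Sum>j<N. B * (2 powr (- c)) ^ j)" by (intro sum_mono level)
        also have "\<dots> = B * (\<Sum>j<N. (2 powr (- c)) ^ j)" by (simp only: sum_distrib_left)
        also have "(\<Sum>j<N. (2 powr (- c)) ^ j) \<le> (\<Sum>j. (2 powr (- c)) ^ j)"
          using summable_geometric[OF small] by (intro sum_le_suminf) auto
        also have "\<dots> = 1 / (1 - 2 powr (- c))" by (rule suminf_geometric[OF small])
        finally show ?thesis using B by (simp add: mult_left_mono)
      qed
      note total = this
      have bound: "(\<integral>\<^sup>+\<omega>. ennreal (exp (\<alpha> * X i \<omega>)) \<partial>P) \<le> ennreal (1 + a i)" if "i \<in> wavelet_index" for i
      proof -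
        have "(\<integral>\<^sup>+\<omega>. ennreal (exp (\<alpha> * X i \<omega>)) \<partial>P) = (\<integral>\<^sup>+z. ennreal (exp (\<alpha> * F i z)) \<partial>\<mu>)"
          by (rule transfer[OF that, of "\<lambda>x. ennreal (exp (\<alpha> * x))"]) measurable
        also have "\<dots> \<le> ennreal (1 + a i)"
          unfolding F_eq a_def using 1(1,2)
          by (intro K(2) D that mult_nonneg_nonpos) (auto intro: order_trans[where y = "- c"])
        finally show ?thesis .
      qed
      have "ennreal \<alpha> * \<rho> \<omega> = (\<Sum>j. \<Sum>i\<in>level_index j. ennreal (\<alpha> * X i \<omega>))" for \<omega>
        using \<alpha>(1) by (simp add: \<rho>_def ennreal_suminf_cmult sum_distrib_left[symmetric] ennreal_mult')
      moreover have "(\<integral>\<^sup>+\<omega>. ennreal_exp (\<Sum>j. \<Sum>i\<in>level_index j. ennreal (\<alpha> * X i \<omega>)) \<partial>P) < \<infinity>"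
        by (rule P.indep_sum_exp_moment_finite[OF indep finite_level_index level_index_subset disjoint_level_index _ bound _ total])
           (use \<alpha>(1) X_nonneg K(1) in \<open>auto simp: a_def\<close>)
      ultimately show "(\<integral>\<^sup>+\<omega>. ennreal_exp (ennreal \<alpha> * \<rho> \<omega>) \<partial>P) < \<infinity>" by simp
    qed
    thus ?thesis using two_one 1(3) by blast
  next

    \<comment> \<open>Positive r: almost sure divergence\<close>
    case 2
    have "(\<lambda>z. ennreal (exp (- (1 / 2) * T.I_q z) / Z)) \<in> borel_measurable borel" by measurable
    then obtain W where W: "0 < W" "\<And>D e. D \<in> sets torus_measure \<Longrightarrow> 0 \<le> e \<Longrightarrow>
       (\<integral>\<^sup>+z. ennreal (exp (- T.F_q (1 / \<delta>) D e z)) \<partial>\<mu>) \<le> ennreal (1 - W * measure torus_measure D)"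
      using T.exp_neg_F_q_moment[OF \<delta>(2) \<mu> _ \<mu>_prob] by blast
    have bound: "(\<integral>\<^sup>+\<omega>. ennreal (exp (- X i \<omega>)) \<partial>P) \<le> ennreal (1 - W * measure torus_measure (D i))"
      if "i \<in> wavelet_index" for i
    proof -
      have "(\<integral>\<^sup>+\<omega>. ennreal (exp (- X i \<omega>)) \<partial>P) = (\<integral>\<^sup>+z. ennreal (exp (- F i z)) \<partial>\<mu>)"
        by (rule transfer[OF that, of "\<lambda>x. ennreal (exp (- x))"]) measurable
      also have "\<dots> \<le> ennreal (1 - W * measure torus_measure (D i))"
        unfolding F_eq using 2(1) by (intro W(2) D that mult_nonneg_nonneg) (auto intro: less_imp_le)
      finally show ?thesis .
    qed
    \<comment> \<open>There is at least one type G per level and its cubes have total measure 1, so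
      W is a lower bound common to all levels.\<close>
    have level: "W \<le> (\<Sum>i\<in>level_index j. W * measure torus_measure (D i))" for j
    proof -
      have "(\<Sum>i\<in>level_index j. W * measure torus_measure (D i)) = W * real (card (G_level j :: (gender^'n) set))"
        using sum_level_index_measure[of j, where 'n = 'n]
        by (simp add: sum_distrib_left[symmetric] D_def case_prod_unfold)
      moreover have "W * 1 \<le> W * real (card (G_level j :: (gender^'n) set))"
        using W(1) card_G_level_bounds(1)[of j, where 'n = 'n] by (intro mult_left_mono) auto
      ultimately show ?thesis by simp
    qed
    have "AE \<omega> in P. \<rho> \<omega> = \<infinity>"
      unfolding \<rho>_def
      using P.indep_sum_diverges[OF indep[of 1, simplified] finite_level_index level_index_subset
          disjoint_level_index X_nonneg bound W(1) level] by simp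
    hence "\<not> ?one"
    proof (intro notI)
      assume "AE \<omega> in P. \<rho> \<omega> = \<infinity>" ?one
      hence "AE \<omega> in P. False" by eventually_elim simp
      thus False by simp
    qed
    \<comment> \<open>All three conditions fail here: the second would imply the first.\<close>
    thus ?thesis using two_one 2(2) by blast
  qed
  thus ?thesis by (simp only: modular r_def Q_def)
qed

end
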